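(* Let $P$ be a simple closed $n$-gon in $\mathbb{R}^2$. (i) If $n\ge4$ and $a,b\in\mathrm{int}P$, then there are vertices $a',b'$ of $P$ such that $]a,a'[\subset\mathrm{int}P$, $]b,b'[\subset\mathrm{int}P$, and $a',b'$ are at most $\lfloor n/2\rfloor-2$ edges apart on $P$. (ii) If $n\ge5$ and $a,b\in\mathrm{ext}P$, then either there are vertices $a',b'$ of $P$ such that $]a,a'[\subset\mathrm{ext}P$, $]b,b'[\subset\mathrm{ext}P$, and $a',b'$ are at most $\lceil n/2\rceil-2$ edges apart on $P$, or $\pi_{\mathrm{ext}P}(a,b)\le3$.
   Context: A simple closed $n$-gon is $P=\bigcup_{i=1}^n[p_{i-1},p_i]$ with distinct vertices $p_0,\dots,p_{n-1}$, $p_n=p_0$, whose edges meet only in common endpoints of consecutive edges. $\mathrm{int}P$ and $\mathrm{ext}P$ are the bounded and unbounded components of $\mathbb{R}^2\setminus P$. $]x,y[$ denotes the open segment. Two vertices $a',b'$ are at most $k$ edges apart on $P$ if one of the two arcs of $P$ between them (a single point if $a'=b'$) consists of at most $k$ edges of $P$. For $S\subset\mathbb{R}^2$, $\pi_S(a,b)$ is the smallest number of edges of a polygonal path connecting $a$ to $b$ within $S$. *)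

theory Defs
  imports "HOL-Analysis.Analysis"
begin

definition polygon_edge :: "nat \<Rightarrow> (nat \<Rightarrow> real^2) \<Rightarrow> nat \<Rightarrow> (real^2) set" where
  "polygon_edge n p i = closed_segment (p i) (p (Suc i mod n))"

definition polygon :: "nat \<Rightarrow> (nat \<Rightarrow> real^2) \<Rightarrow> (real^2) set" where
  "polygon n p = (\<Union>i<n. polygon_edge n p i)"

definition simple_polygon :: "nat \<Rightarrow> (nat \<Rightarrow> real^2) \<Rightarrow> bool" where
  "simple_polygon n p \<longleftrightarrow> n \<ge> 3 \<and> inj_on p {..<n} \<and>
     (\<forall>i<n. \<forall>j<n. i \<noteq> j \<longrightarrow>
        polygon_edge n p i \<inter> polygon_edge n p j =
          (if j = Suc i mod n then {p j} else if i = Suc j mod n then {p i} else {}))"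

definition int_polygon :: "(real^2) set \<Rightarrow> (real^2) set" where
  "int_polygon P = {x. x \<notin> P \<and> bounded (connected_component_set (- P) x)}"

definition ext_polygon :: "(real^2) set \<Rightarrow> (real^2) set" where
  "ext_polygon P = {x. x \<notin> P \<and> \<not> bounded (connected_component_set (- P) x)}"

text \<open>Vertices p i and p j (i, j < n) are at most k edges apart: one of the two
  arcs between them has at most k edges.\<close>

definition at_most_edges_apart :: "nat \<Rightarrow> nat \<Rightarrow> nat \<Rightarrow> nat \<Rightarrow> bool" where
  "at_most_edges_apart n i j k \<longleftrightarrow>
     ((n + j - i) mod n \<le> k \<or> (n + i - j) mod n \<le> k)"

definition polygonal_path_in :: "(real^2) set \<Rightarrow> real^2 \<Rightarrow> real^2 \<Rightarrow> nat \<Rightarrow> bool" where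
  "polygonal_path_in S a b m \<longleftrightarrow> (\<exists>q :: nat \<Rightarrow> real^2. q 0 = a \<and> q m = b \<and>
      (\<forall>i<m. closed_segment (q i) (q (Suc i)) \<subseteq> S))"

definition link_dist :: "(real^2) set \<Rightarrow> real^2 \<Rightarrow> real^2 \<Rightarrow> nat" where
  "link_dist S a b = (LEAST m. polygonal_path_in S a b m)"

end

theory Submission
  imports Defs
begin

text \<open>Triangulate the interior by diagonals and the pockets between the polygon and its convex hull
  by diagonals as well. A point sees the vertices of the triangle containing it, and the triangles of
  two points have vertex sets \<open>I\<close>, \<open>J\<close> that do not interleave along the polygon. If \<open>I\<close> and \<open>J\<close> are
  disjoint, each thus lies in one cyclic gap of the other; two triangles use up at least four edges,
  so the two gaps between them have at most \<open>n - 4\<close> edges in total, and the shorter one has at most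
  \<open>\<lfloor>n/2\<rfloor> - 2\<close>. A point outside the convex hull sees both ends of an edge of the hull instead, which
  costs one edge less and yields \<open>\<lceil>n/2\<rceil> - 2\<close>. Two points outside the hull escape to infinity in a
  common direction and are joined there.\<close>

section \<open>Non-crossing index sets\<close>

text \<open>The triangulations never appear as objects. The inductions on the number of vertices
  prove a statement about two points at once, \<open>cell_pair\<close>: if a chord separates the
  points, their cells use indices on different sides of that chord and cannot interleave; otherwise
  both points belong to the same smaller polygon, whose vertices are renumbered in increasing order.
  The exterior is harder in two respects. A lid of the hull does not cut it into two exteriors: one
  part is the inside of a pocket, settled by the interior result, the other is the outside of the
  polygon with that pocket filled in, settled by induction. And the indices do not tell which of the
  two chains between the ends of the lid bounds the pocket; the Jordan curve theorem has to decide
  it. Two points outside the hull need the alternative with three links because two hull edges use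
  up only two edges of the polygon, which for even \<open>n\<close> is one too few for the
  bound.\<close>

definition alternating :: "nat set \<Rightarrow> nat set \<Rightarrow> bool" where
  "alternating I J \<longleftrightarrow> (\<exists>i\<in>I. \<exists>j\<in>J. \<exists>i'\<in>I. \<exists>j'\<in>J. i < j \<and> j < i' \<and> i' < j')"

text \<open>Four positions interleave along the cycle iff they do so when read linearly from index
  0; which set then comes first depends on the starting point, hence both orders are excluded. The
  inequalities are strict, so common elements are allowed and a triple does not cross
  itself.\<close>

definition noncrossing :: "nat set \<Rightarrow> nat set \<Rightarrow> bool" where
  "noncrossing I J \<longleftrightarrow> \<not> alternating I J \<and> \<not> alternating J I"

lemma noncrossing_sym: "noncrossing I J \<Longrightarrow> noncrossing J I"
  unfolding noncrossing_def by simp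

lemma alternating_imageD:
  assumes "strict_mono_on {..<m} s" "I \<subseteq> {..<m}" "J \<subseteq> {..<m}" "alternating (s ` I) (s ` J)"
  shows "alternating I J"
proof -
  have less: "x < y" if "s x < s y" "x \<in> I \<union> J" "y \<in> I \<union> J" for x y
    using assms(1-3) that strict_mono_on_less[OF assms(1), of x y] by auto
  obtain i j i' j' where "i \<in> I" "j \<in> J" "i' \<in> I" "j' \<in> J" "s i < s j" "s j < s i'" "s i' < s j'"
    using assms(4) unfolding alternating_def by auto
  then show ?thesis
    unfolding alternating_def using less by (intro bexI[of _ i] bexI[of _ j] bexI[of _ i'] bexI[of _ j']) auto
qed

text \<open>Carries non-crossing cells from a polygon cut off by a chord to the whole polygon, since
  the renumbering of its vertices is increasing.\<close>

lemma noncrossing_image: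
  assumes "strict_mono_on {..<m} s" "I \<subseteq> {..<m}" "J \<subseteq> {..<m}" "noncrossing I J"
  shows "noncrossing (s ` I) (s ` J)"
  using assms alternating_imageD unfolding noncrossing_def by blast

section \<open>Cyclic distance between non-crossing sets\<close>

lemma at_most_edges_apart_sym: "at_most_edges_apart n i j k \<Longrightarrow> at_most_edges_apart n j i k"
  unfolding at_most_edges_apart_def by blast

lemma at_most_edges_apartI:
  assumes "i < n" "j < n" "i \<le> j" "j - i \<le> k \<or> n - (j - i) \<le> k"
  shows "at_most_edges_apart n i j k"
proof (cases "i = j")
  case False
  have "(n + j - i) mod n = j - i"
    using assms by (simp add: le_mod_geq)
  moreover have "(n + i - j) mod n = n - (j - i)"
    using assms False by simp
  ultimately show ?thesis
    using assms(4) unfolding at_most_edges_apart_def by auto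
qed (use assms in \<open>simp add: at_most_edges_apart_def\<close>)

text \<open>Disjoint non-crossing sets lie in one cyclic gap of each other, so the two connecting gaps
  together contain at most \<open>n\<close> minus the widths of the two sets many edges.\<close>

lemma noncrossing_close_aux:
  fixes n k w :: nat
  assumes nc: "noncrossing I J"
    and i: "i1 < i2" "i2 < i3" "{i1,i2,i3} \<subseteq> I" "I \<subseteq> {..<n}"
    and j: "j1 < j2" "{j1,j2} \<subseteq> J" "J \<subseteq> {..<n}"
    and k: "n \<le> 2 * k + 3 + w"
    and w_between: "j1 < i1 \<Longrightarrow> i1 < j2 \<Longrightarrow> w + (j2 - j1) \<le> n"
    and w: "\<not> (j1 < i1 \<and> i1 < j2) \<Longrightarrow> j1 + w \<le> j2"
  shows "\<exists>i\<in>I. \<exists>j\<in>J. at_most_edges_apart n i j k"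
\<comment> \<open>\<open>w\<close> bounds from below the number of edges on that arc between
  \<open>j1\<close> and \<open>j2\<close> which avoids \<open>i1\<close>; the last two hypotheses
  differ in which of the two arcs this is. The triple takes up at least 2 edges, so two connecting
  gaps of at least k + 1 edges each would require n \<ge> 2 * k + 4 + w.\<close>
proof (rule ccontr)
  assume "\<not> ?thesis"
  then have far: "\<not> at_most_edges_apart n i j k" if "i \<in> I" "j \<in> J" for i j
    using that by blast
  \<comment> \<open>Both arcs between \<open>i\<close> and \<open>j\<close> have more than
    \<open>k\<close> edges, written without subtraction on \<open>nat\<close>.\<close>
  have far1: "i + k < j \<and> j + k < n + i \<or> j + k < i \<and> i + k < n + j" if "i \<in> I" "j \<in> J" for i j
  proof (cases "i \<le> j")
    case True
    have "\<not> (j - i \<le> k \<or> n - (j - i) \<le> k)"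
      using at_most_edges_apartI[of i n j k] far[OF that] that i j True by blast
    then show ?thesis using that i j True by auto
  next
    case False
    have "\<not> (i - j \<le> k \<or> n - (i - j) \<le> k)"
      using at_most_edges_apartI[of j n i k] far[OF that] that i j False
      by (meson at_most_edges_apart_sym lessThan_iff nat_le_linear subsetD)
    then show ?thesis using that i j False by auto
  qed
  have n: "i3 < n" "j2 < n" using i j by auto
  have nc': "\<not> (i < j \<and> j < i' \<and> i' < j')" "\<not> (j < i \<and> i < j' \<and> j' < i')"
    if "i \<in> I" "i' \<in> I" "j \<in> J" "j' \<in> J" for i i' j j'
    using nc that unfolding noncrossing_def alternating_def by blast+
  have I: "i1 \<in> I" "i2 \<in> I" "i3 \<in> I" and J: "j1 \<in> J" "j2 \<in> J" using i j by auto
  have less: "i + k < j \<and> j + k < n + i" if "i < j" "i \<in> I" "j \<in> J" for i j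
    using far1[of i j] that by auto
  have greater: "j + k < i \<and> i + k < n + j" if "j < i" "i \<in> I" "j \<in> J" for i j
    using far1[of i j] that by auto
  have ne: "i \<noteq> j" if "i \<in> I" "j \<in> J" for i j
    using far1[OF that] by auto
  note ne = ne[OF I(1) J(1)] ne[OF I(1) J(2)] ne[OF I(2) J(1)] ne[OF I(2) J(2)]
    ne[OF I(3) J(1)] ne[OF I(3) J(2)]
  note c = nc'[OF I(1) I(2) J] nc'[OF I(1) I(3) J] nc'[OF I(2) I(3) J]
  \<comment> \<open>By \<open>far\<close> the sets are disjoint, so \<open>j1\<close> falls into a
    gap of i1 < i2 < i3, and non-crossing forces \<open>j2\<close> into the same cyclic gap. The gap
    through index 0 accounts for the first, second and last of the five cases.\<close>
  have "j1 < i1 \<or> i1 < j1 \<and> j1 < i2 \<or> i2 < j1 \<and> j1 < i3 \<or> i3 < j1"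
    using ne by (metis linorder_less_linear)
  then consider "j1 < i1" "j2 < i1" | "j1 < i1" "i3 < j2" | "i1 < j1" "j2 < i2"
    | "i2 < j1" "j2 < i3" | "i3 < j1"
    using c ne by (metis i(1,2) linorder_less_linear order.strict_trans)
  then show False
  proof cases
    case 1 with greater[OF _ I(1) J(2)] greater[OF _ I(3) J(1)] show ?thesis
      using n k w w_between i(1,2) j(1) by linarith
  next
    case 2 with greater[OF _ I(1) J(1)] less[OF _ I(3) J(2)] show ?thesis
      using n k w w_between i(1,2) j(1) by linarith
  next
    case 3 with less[OF _ I(1) J(1)] greater[OF _ I(2) J(2)] show ?thesis
      using n k w w_between i(1,2) j(1) by linarith
  next
    case 4 with less[OF _ I(2) J(1)] greater[OF _ I(3) J(2)] show ?thesis
      using n k w w_between i(1,2) j(1) by linarith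
  next
    case 5 with less[OF _ I(3) J(1)] less[OF _ I(1) J(2)] show ?thesis
      using n k w w_between i(1,2) j(1) by linarith
  qed
qed

lemma noncrossing_triple_pair_close:
  assumes "noncrossing I J"
    and i: "i1 < i2" "i2 < i3" "{i1,i2,i3} \<subseteq> I" "I \<subseteq> {..<n}"
    and j: "j1 < j2" "{j1,j2} \<subseteq> J" "J \<subseteq> {..<n}"
  shows "\<exists>i\<in>I. \<exists>j\<in>J. at_most_edges_apart n i j ((n + 1) div 2 - 2)"
proof (rule noncrossing_close_aux[OF assms, where w = 1])
  show "n \<le> 2 * ((n + 1) div 2 - 2) + 3 + 1" by linarith
  show "1 + (j2 - j1) \<le> n" using j by auto
  show "j1 + 1 \<le> j2" using j by auto
qed

lemma noncrossing_triples_close: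
  assumes nc: "noncrossing I J"
    and i: "i1 < i2" "i2 < i3" "{i1,i2,i3} \<subseteq> I" "I \<subseteq> {..<n}"
    and j: "j1 < j2" "j2 < j3" "{j1,j2,j3} \<subseteq> J" "J \<subseteq> {..<n}"
  shows "\<exists>i\<in>I. \<exists>j\<in>J. at_most_edges_apart n i j (n div 2 - 2)"
proof -
  have k: "n \<le> 2 * (n div 2 - 2) + 3 + 2" by linarith
  have *: "i1 \<in> I" "j1 \<in> J" "j2 \<in> J" "j3 \<in> J" "j3 < n" using i j by auto
  \<comment> \<open>The pair is picked from the triple so that its arc away from \<open>i1\<close>
    runs over the third element; this gives it width 2 instead of 1.\<close>
  consider "i1 = j2" | "j1 < i1" "i1 < j2" | "j2 < i1" "i1 < j3" | "i1 \<le> j1 \<or> j3 \<le> i1"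
    by linarith
  then show ?thesis
  proof cases
    case 1
    then show ?thesis using * at_most_edges_apart_def by (metis add_diff_cancel_right' mod_self zero_le)
  next
    case 2
    show ?thesis
      by (rule noncrossing_close_aux[OF nc i j(1) _ j(4) k]) (use 2 * j in auto)
  next
    case 3
    show ?thesis
      by (rule noncrossing_close_aux[OF nc i j(2) _ j(4) k]) (use 3 * j in auto)
  next
    case 4
    have "j1 < j3" using j by simp
    then show ?thesis
      by (rule noncrossing_close_aux[OF nc i _ _ j(4) k]) (use 4 * j in auto)
  qed
qed

section \<open>The Jordan curve theorem in the real plane\<close>

text \<open>The component of \<open>f x\<close> in the complement of the image is pulled back by
  \<open>g\<close> to a connected set around \<open>x\<close> that avoids \<open>S\<close>. That set
  is bounded, and \<open>f\<close> keeps it bounded.\<close>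

lemma linear_image_inside_subset:
  fixes f :: "'a::euclidean_space \<Rightarrow> 'b::euclidean_space"
  assumes f: "linear f" and g: "linear g" "\<And>x. g (f x) = x" "\<And>y. f (g y) = y"
  shows "f ` inside S \<subseteq> inside (f ` S)"
proof clarify
  fix x assume x: "x \<in> inside S"
  let ?C = "connected_component_set (- (f ` S)) (f x)"
  have "x \<notin> S" using x by (simp add: inside_def)
  then have "x \<in> g ` ?C"
    using g by (metis (no_types, lifting) ComplI connected_component_refl_eq image_iff mem_Collect_eq)
  moreover have "connected (g ` ?C)"
    using g(1) by (intro connected_linear_image) (simp_all add: connected_connected_component linear_conv_bounded_linear)
  moreover have "g ` ?C \<subseteq> - S"
    using connected_component_subset[of "- (f ` S)" "f x"] g(3) by (force simp: subset_iff image_iff)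
  ultimately have "g ` ?C \<subseteq> connected_component_set (- S) x"
    by (rule connected_component_maximal)
  then have "bounded (g ` ?C)"
    using x bounded_subset unfolding inside_def by blast
  then have "bounded (f ` g ` ?C)"
    using f bounded_linear_image linear_conv_bounded_linear by blast
  then have "bounded ?C" using g by (simp add: image_image)
  moreover have "f x \<notin> f ` S" using \<open>x \<notin> S\<close> g by (metis imageE)
  ultimately show "f x \<in> inside (f ` S)" by (simp add: inside_def)
qed

lemma inside_linear_image_eq:
  fixes f :: "'a::euclidean_space \<Rightarrow> 'b::euclidean_space"
  assumes f: "linear f" and g: "linear g" "\<And>x. g (f x) = x" "\<And>y. f (g y) = y"
  shows "inside (f ` S) = f ` inside S"
proof
  have "g ` inside (f ` S) \<subseteq> inside (g ` f ` S)"
    by (rule linear_image_inside_subset) (use assms in auto)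
  then show "inside (f ` S) \<subseteq> f ` inside S"
    using g by (auto simp: image_image image_iff) (metis (lifting) image_subset_iff)
qed (rule linear_image_inside_subset[OF assms])

text \<open>\<open>Jordan_inside_outside\<close> and \<open>split_inside_simple_closed_curve\<close>
  speak of curves in \<open>complex\<close>; this isomorphism carries them over to
  \<open>real^2\<close>.\<close>

definition cplx :: "real^2 \<Rightarrow> complex" where "cplx x = Complex (x $ 1) (x $ 2)"
definition vec2 :: "complex \<Rightarrow> real^2" where "vec2 z = vector [Re z, Im z]"

lemma vec2_cplx: "vec2 (cplx x) = x"
  by (simp add: vec2_def cplx_def vec_eq_iff forall_2)

lemma cplx_vec2: "cplx (vec2 z) = z"
  by (simp add: vec2_def cplx_def)

lemma linear_cplx: "linear cplx"
  by (rule linearI) (simp_all add: cplx_def complex_eq_iff)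

lemma linear_vec2: "linear vec2"
  by (rule linearI) (simp_all add: vec2_def vec_eq_iff forall_2)

lemma inj_cplx: "inj cplx"
  by (metis injI vec2_cplx)

lemma inside_cplx: "inside (cplx ` S) = cplx ` inside S"
  by (rule inside_linear_image_eq[OF linear_cplx linear_vec2 vec2_cplx cplx_vec2])

lemma Jordan_real2:
  fixes c :: "real \<Rightarrow> real^2"
  assumes "simple_path c" "pathfinish c = pathstart c"
  shows "inside (path_image c) \<noteq> {}" "connected (inside (path_image c))"
    "frontier (inside (path_image c)) = path_image c"
proof -
  let ?P = "path_image c"
  have *: "path_image (cplx \<circ> c) = cplx ` ?P"
    by (rule path_image_compose)
  have "simple_path (cplx \<circ> c)" "pathfinish (cplx \<circ> c) = pathstart (cplx \<circ> c)"
    using assms simple_path_linear_image_eq[OF linear_cplx inj_cplx] by (auto simp: pathfinish_compose pathstart_compose)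
  from Jordan_inside_outside[OF this]
  have J: "cplx ` inside ?P \<noteq> {}" "connected (cplx ` inside ?P)" "frontier (cplx ` inside ?P) = cplx ` ?P"
    unfolding * inside_cplx by auto
  show "inside ?P \<noteq> {}" using J by auto
  have "connected (vec2 ` cplx ` inside ?P)"
    by (rule connected_linear_image[OF linear_vec2 J(2)])
  then show "connected (inside ?P)" by (simp add: image_image vec2_cplx)
  have "bij cplx" by (rule o_bij[of vec2]) (auto simp: vec2_cplx cplx_vec2)
  then have "frontier (cplx ` inside ?P) = cplx ` frontier (inside ?P)"
    unfolding frontier_def closure_injective_linear_image[OF linear_cplx inj_cplx, symmetric]
      interior_bijective_linear_image[OF linear_cplx \<open>bij cplx\<close>]
    by (simp add: image_set_diff inj_cplx)
  then show "frontier (inside ?P) = ?P"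
    using J(3) inj_cplx by (simp add: inj_image_eq_iff)
qed

text \<open>The theta-curve theorem: an arc that joins two points of a closed curve and enters its
  inside cuts the inside in two. All cuts along chords rest on it.\<close>

lemma split_inside_real2:
  fixes c :: "real \<Rightarrow> real^2"
  assumes "simple_path c1" and c1: "pathstart c1 = a" "pathfinish c1 = b"
      and "simple_path c2" and c2: "pathstart c2 = a" "pathfinish c2 = b"
      and "simple_path c"  and c: "pathstart c = a" "pathfinish c = b"
      and "a \<noteq> b"
      and "path_image c1 \<inter> path_image c2 = {a,b}"
      and "path_image c1 \<inter> path_image c = {a,b}"
      and "path_image c2 \<inter> path_image c = {a,b}"
      and "path_image c \<inter> inside(path_image c1 \<union> path_image c2) \<noteq> {}"
  shows "inside(path_image c1 \<union> path_image c) \<inter> inside(path_image c2 \<union> path_image c) = {}"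
    "inside(path_image c1 \<union> path_image c) \<union> inside(path_image c2 \<union> path_image c) \<union>
           (path_image c - {a,b}) = inside(path_image c1 \<union> path_image c2)"
proof -
  note im = image_Un[symmetric] image_Int[OF inj_cplx, symmetric] image_set_diff[OF inj_cplx, symmetric]
    inside_cplx path_image_compose
  have e: "{cplx a, cplx b} = cplx ` {a, b}" by simp
  have "inside(path_image (cplx \<circ> c1) \<union> path_image (cplx \<circ> c)) \<inter> inside(path_image (cplx \<circ> c2) \<union> path_image (cplx \<circ> c)) = {} \<and>
    inside(path_image (cplx \<circ> c1) \<union> path_image (cplx \<circ> c)) \<union> inside(path_image (cplx \<circ> c2) \<union> path_image (cplx \<circ> c)) \<union>
           (path_image (cplx \<circ> c) - {cplx a,cplx b}) = inside(path_image (cplx \<circ> c1) \<union> path_image (cplx \<circ> c2))"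
    by (rule split_inside_simple_closed_curve[of "cplx \<circ> c1" "cplx a" "cplx b" "cplx \<circ> c2" "cplx \<circ> c"])
      (use assms in \<open>simp_all only: simple_path_linear_image_eq[OF linear_cplx inj_cplx] pathstart_compose pathfinish_compose
         im e, simp_all add: inj_eq[OF inj_cplx]\<close>)
  then show "inside(path_image c1 \<union> path_image c) \<inter> inside(path_image c2 \<union> path_image c) = {}"
    "inside(path_image c1 \<union> path_image c) \<union> inside(path_image c2 \<union> path_image c) \<union>
           (path_image c - {a,b}) = inside(path_image c1 \<union> path_image c2)"
    unfolding im e by (simp_all only: image_is_empty inj_image_eq_iff[OF inj_cplx])
qed

section \<open>Simple polygons and chords\<close>

lemma Suc_mod_if: "k < n \<Longrightarrow> Suc k mod n = (if Suc k = n then 0 else Suc k)"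
  by simp

lemma vertex_in_edge: "p k \<in> polygon_edge n p k" "p (Suc k mod n) \<in> polygon_edge n p k"
  by (simp_all add: polygon_edge_def)

lemma simple_polygon_edgesD:
  assumes P: "simple_polygon n p" and kl: "k < n" "l < n" "k \<noteq> l"
    and x: "x \<in> polygon_edge n p k" "x \<in> polygon_edge n p l"
  obtains m where "x = p m" "m = k \<or> m = Suc k mod n" "m = l \<or> m = Suc l mod n"
proof -
  have "polygon_edge n p k \<inter> polygon_edge n p l =
          (if l = Suc k mod n then {p l} else if k = Suc l mod n then {p k} else {})"
    using P kl unfolding simple_polygon_def by blast
  then show ?thesis
    using x that by (auto split: if_splits)
qed

lemma simple_polygon_vertexD:
  assumes P: "simple_polygon n p" and kl: "k < n" "m < n" and x: "p m \<in> polygon_edge n p k"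
  shows "m = k \<or> m = Suc k mod n"
proof (cases "m = k")
  case False
  obtain i where i: "p m = p i" "i = m \<or> i = Suc m mod n" "i = k \<or> i = Suc k mod n"
    using simple_polygon_edgesD[OF P kl(2,1) False vertex_in_edge(1) x] by metis
  have "inj_on p {..<n}" "i < n" using P i kl unfolding simple_polygon_def by auto
  then have "m = i" using i(1) kl by (meson inj_onD lessThan_iff)
  then show ?thesis using i by blast
qed simp

text \<open>Intersections of edges are reduced to incidences: by \<open>X\<close> a common point is
  a vertex, and by \<open>V\<close> this vertex is an end of both edges, so they are consecutive.
  For n \<ge> 3 two edges share at most one end.\<close>

lemma simple_polygonI:
  assumes n: "n \<ge> 3" and inj: "inj_on p {..<n}"
    and V: "\<And>m k. m < n \<Longrightarrow> k < n \<Longrightarrow> p m \<in> polygon_edge n p k \<Longrightarrow> m = k \<or> m = Suc k mod n"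
    and X: "\<And>k l. k < n \<Longrightarrow> l < n \<Longrightarrow> k \<noteq> l \<Longrightarrow> polygon_edge n p k \<inter> polygon_edge n p l \<subseteq> p ` {..<n}"
  shows "simple_polygon n p"
proof -
  have "polygon_edge n p k \<inter> polygon_edge n p l =
          (if l = Suc k mod n then {p l} else if k = Suc l mod n then {p k} else {})"
    if kl: "k < n" "l < n" "k \<noteq> l" for k l
  proof
    show "(if l = Suc k mod n then {p l} else if k = Suc l mod n then {p k} else {})
       \<subseteq> polygon_edge n p k \<inter> polygon_edge n p l"
      using vertex_in_edge[of p k n] vertex_in_edge[of p l n] by auto
    show "polygon_edge n p k \<inter> polygon_edge n p l
       \<subseteq> (if l = Suc k mod n then {p l} else if k = Suc l mod n then {p k} else {})"
    proof
      fix x assume x: "x \<in> polygon_edge n p k \<inter> polygon_edge n p l"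
      then obtain m where m: "m < n" "x = p m" using X[OF kl] by blast
      have "m = k \<or> m = Suc k mod n" "m = l \<or> m = Suc l mod n"
        using V m x kl by blast+
      then show "x \<in> (if l = Suc k mod n then {p l} else if k = Suc l mod n then {p k} else {})"
        using kl n m by (auto simp: Suc_mod_if split: if_splits)
    qed
  qed
  then show ?thesis
    using n inj unfolding simple_polygon_def by blast
qed

lemma polygon_edge_subset: "k < n \<Longrightarrow> polygon_edge n p k \<subseteq> polygon n p"
  unfolding polygon_def by blast

lemma vertex_in_polygon: "k < n \<Longrightarrow> p k \<in> polygon n p"
  using polygon_edge_subset vertex_in_edge(1) by blast

lemma polygon_edge_comp:
  "s (Suc k mod m) = Suc (s k) mod n \<Longrightarrow> polygon_edge m (p \<circ> s) k = polygon_edge n p (s k)"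
  by (simp add: polygon_edge_def)

text \<open>Serves both polygons that a chord cuts off: \<open>s\<close> lists the vertices that are
  kept, edge \<open>d\<close> is the chord, and every other edge is an edge of the old polygon. As
  the open chord avoids the old polygon, it adds incidences at its ends only.\<close>

lemma simple_polygon_sub:
  assumes P: "simple_polygon n p" and m: "m \<ge> 3"
    and s: "inj_on s {..<m}" "s ` {..<m} \<subseteq> {..<n}"
    and e: "\<And>k. k < m \<Longrightarrow> k \<noteq> d \<Longrightarrow> s (Suc k mod m) = Suc (s k) mod n"
    and d: "d < m"
    and D: "open_segment (p (s d)) (p (s (Suc d mod m))) \<inter> polygon n p = {}"
  shows "simple_polygon m (p \<circ> s)"
proof (rule simple_polygonI[OF m])
  have inj: "inj_on p {..<n}" using P unfolding simple_polygon_def by blast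
  show inj': "inj_on (p \<circ> s) {..<m}"
    using comp_inj_on[OF s(1)] inj s(2) inj_on_subset by blast
  have d': "Suc d mod m < m" using m by simp
  have edge: "polygon_edge m (p \<circ> s) k = polygon_edge n p (s k)" if "k < m" "k \<noteq> d" for k
    by (rule polygon_edge_comp) (rule e[OF that])
  have edge_d: "x = (p \<circ> s) d \<or> x = (p \<circ> s) (Suc d mod m)"
    if "x \<in> polygon_edge m (p \<circ> s) d" "x \<in> polygon n p" for x
    using that D unfolding polygon_edge_def open_segment_def by auto
  have sn: "s k < n" if "k < m" for k using s(2) that by auto
  show "a = k \<or> a = Suc k mod m" if ak: "a < m" "k < m" "(p \<circ> s) a \<in> polygon_edge m (p \<circ> s) k" for a k
  proof (cases "k = d")
    case True
    have "(p \<circ> s) a \<in> polygon n p" using vertex_in_polygon sn ak by simp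
    then have "(p \<circ> s) a = (p \<circ> s) d \<or> (p \<circ> s) a = (p \<circ> s) (Suc d mod m)"
      using edge_d ak True by blast
    then show ?thesis
      using inj_onD[OF inj'] ak d d' True by (metis lessThan_iff)
  next
    case False
    then have "s a = s k \<or> s a = Suc (s k) mod n"
      using simple_polygon_vertexD[OF P sn[OF ak(2)] sn[OF ak(1)]] ak edge by simp
    then have "s a = s k \<or> s a = s (Suc k mod m)" using e ak False by simp
    then show ?thesis
      using inj_onD[OF s(1)] ak by (metis d' gr_implies_not0 lessThan_iff mod_less_divisor neq0_conv)
  qed
  have X: "polygon_edge m (p \<circ> s) k \<inter> polygon_edge m (p \<circ> s) l \<subseteq> (p \<circ> s) ` {..<m}"
    if kl: "k < m" "l < m" "k \<noteq> l" "l \<noteq> d" for k l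
  proof
    fix x assume x: "x \<in> polygon_edge m (p \<circ> s) k \<inter> polygon_edge m (p \<circ> s) l"
    then have xl: "x \<in> polygon_edge n p (s l)" using edge kl by blast
    have S: "Suc l mod m < m" "Suc k mod m < m" using m by auto
    show "x \<in> (p \<circ> s) ` {..<m}"
    proof (cases "k = d")
      case True
      have "x \<in> polygon n p" using xl polygon_edge_subset[OF sn] kl by blast
      then show ?thesis using edge_d x True d d' by (metis IntD1 image_eqI lessThan_iff)
    next
      case False
      then have "x \<in> polygon_edge n p (s k)" using x edge kl by blast
      moreover have "s k \<noteq> s l" using s(1) kl by (meson inj_onD lessThan_iff)
      ultimately obtain a where a: "x = p a" "a = s k \<or> a = Suc (s k) mod n"
        using simple_polygon_edgesD[OF P sn sn] kl xl by metis
      then have "a = s k \<or> a = s (Suc k mod m)" using e False kl by simp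
      then show ?thesis using a(1) S kl by auto
    qed
  qed
  show "polygon_edge m (p \<circ> s) k \<inter> polygon_edge m (p \<circ> s) l \<subseteq> (p \<circ> s) ` {..<m}"
    if kl: "k < m" "l < m" "k \<noteq> l" for k l
    using X[of k l] X[of l k] kl by (cases "l = d") auto
qed

section \<open>Chains of consecutive edges\<close>

lemma mod_neq_nat: "(a::nat) < b \<Longrightarrow> b < a + n \<Longrightarrow> a mod n \<noteq> b mod n"
  by (metis less_diff_conv2 less_imp_le_nat mod_eq_dvd_iff_nat add.commute nat_dvd_not_less zero_less_diff)

text \<open>Edge numbers run past \<open>n\<close> and are reduced modulo \<open>n\<close>, so that
  a chain may pass over vertex 0; \<open>l < n\<close> keeps it from closing up.\<close>

lemma polygon_arc:
  assumes P: "simple_polygon n p" and l: "1 \<le> l" "l < n"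
  shows "\<exists>c. arc c \<and> pathstart c = p (s mod n) \<and> pathfinish c = p ((s + l) mod n) \<and>
    path_image c = (\<Union>k\<in>{s..<s + l}. polygon_edge n p (k mod n))"
  using l
proof (induction l rule: nat_induct_at_least)
  case base
  have "s mod n \<noteq> Suc s mod n" using base by (intro mod_neq_nat) auto
  moreover have "inj_on p {..<n}" using P unfolding simple_polygon_def by blast
  ultimately have "p (s mod n) \<noteq> p (Suc s mod n)"
    using base by (metis inj_onD lessThan_iff mod_less_divisor order.strict_trans zero_less_one)
  then show ?case
    by (intro exI[of _ "linepath (p (s mod n)) (p (Suc s mod n))"])
      (simp add: polygon_edge_def mod_Suc_eq arc_linepath)
next
  case (Suc l)
  then obtain c where c: "arc c" "pathstart c = p (s mod n)" "pathfinish c = p ((s + l) mod n)"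
    "path_image c = (\<Union>k\<in>{s..<s + l}. polygon_edge n p (k mod n))" by auto
  let ?g = "linepath (p ((s + l) mod n)) (p (Suc (s + l) mod n))"
  have g: "path_image ?g = polygon_edge n p ((s + l) mod n)"
    by (simp add: polygon_edge_def mod_Suc_eq)
  have n: "0 < n" using Suc by simp
  have "(s + l) mod n \<noteq> Suc (s + l) mod n" using Suc by (intro mod_neq_nat) auto
  moreover have "inj_on p {..<n}" using P unfolding simple_polygon_def by blast
  ultimately have "p ((s + l) mod n) \<noteq> p (Suc (s + l) mod n)"
    using n by (metis inj_onD lessThan_iff mod_less_divisor)
  then have "arc ?g" by (rule arc_linepath)
  moreover have "path_image c \<inter> path_image ?g \<subseteq> {pathstart ?g}"
  proof
    fix x assume x: "x \<in> path_image c \<inter> path_image ?g"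
    then obtain k where k: "s \<le> k" "k < s + l" "x \<in> polygon_edge n p (k mod n)"
      using c(4) by auto
    \<comment> \<open>These exclude every coincidence between ends of the edges \<open>k\<close> and
      \<open>s + l\<close> except that of \<open>Suc k\<close> with \<open>s + l\<close>, the vertex
      where the new edge is attached.\<close>
    have ne: "k mod n \<noteq> (s + l) mod n" "k mod n \<noteq> Suc (s + l) mod n" "Suc k mod n \<noteq> Suc (s + l) mod n"
      using k Suc.prems by (intro mod_neq_nat; simp)+
    obtain m where m: "x = p m" "m = k mod n \<or> m = Suc (k mod n) mod n"
      "m = (s + l) mod n \<or> m = Suc ((s + l) mod n) mod n"
      using simple_polygon_edgesD[OF P _ _ ne(1) k(3)] x n unfolding g by auto
    then show "x \<in> {pathstart ?g}" using ne by (auto simp: mod_Suc_eq)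
  qed
  ultimately have "arc (c +++ ?g)" using c by (intro arc_join) auto
  moreover have "path_image (c +++ ?g) = (\<Union>k\<in>{s..<s + Suc l}. polygon_edge n p (k mod n))"
    using c g by (simp add: path_image_join atLeastLessThanSuc Un_commute)
  ultimately show ?case
    using c by (intro exI[of _ "c +++ ?g"]) simp
qed

definition inner_chain :: "nat \<Rightarrow> (nat \<Rightarrow> real^2) \<Rightarrow> nat \<Rightarrow> nat \<Rightarrow> (real^2) set" where
  "inner_chain n p i j = (\<Union>k\<in>{i..<j}. polygon_edge n p k)"

definition outer_chain :: "nat \<Rightarrow> (nat \<Rightarrow> real^2) \<Rightarrow> nat \<Rightarrow> nat \<Rightarrow> (real^2) set" where
  "outer_chain n p i j = (\<Union>k\<in>{..<i} \<union> {j..<n}. polygon_edge n p k)"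

lemma polygon_eq_chains: "i < j \<Longrightarrow> j < n \<Longrightarrow> polygon n p = inner_chain n p i j \<union> outer_chain n p i j"
  unfolding polygon_def inner_chain_def outer_chain_def UN_Un[symmetric]
  by (rule arg_cong[where f = "\<lambda>I. \<Union>k\<in>I. polygon_edge n p k"]) auto

text \<open>The outer chain is built from \<open>j\<close> over index 0 up to \<open>i\<close> and
  then reversed, so that both arcs run from \<open>p i\<close> to \<open>p j\<close>, as the
  theta-curve theorem wants them.\<close>

lemma chain_arcs:
  assumes P: "simple_polygon n p" and ij: "i < j" "j < n"
  obtains c1 c2 where "arc c1" "pathstart c1 = p i" "pathfinish c1 = p j" "path_image c1 = inner_chain n p i j"
    "arc c2" "pathstart c2 = p i" "pathfinish c2 = p j" "path_image c2 = outer_chain n p i j"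
proof -
  obtain c1 where c1: "arc c1" "pathstart c1 = p (i mod n)" "pathfinish c1 = p ((i + (j - i)) mod n)"
    "path_image c1 = (\<Union>k\<in>{i..<i + (j - i)}. polygon_edge n p (k mod n))"
    using polygon_arc[OF P, of "j - i" i] ij by (metis One_nat_def Suc_leI less_imp_diff_less zero_less_diff)
  have l: "1 \<le> n - (j - i)" "n - (j - i) < n" using ij by auto
  obtain c2 where c2: "arc c2" "pathstart c2 = p (j mod n)" "pathfinish c2 = p ((j + (n - (j - i))) mod n)"
    "path_image c2 = (\<Union>k\<in>{j..<j + (n - (j - i))}. polygon_edge n p (k mod n))"
    using polygon_arc[OF P l, of j] by blast
  have "{j..<j + (n - (j - i))} = {j..<n} \<union> (\<lambda>k. k + n) ` {..<i}"
  proof -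
    have "j + (n - (j - i)) = n + i" using ij by simp
    moreover have "{j..<n + i} = {j..<n} \<union> {n..<n + i}" using ij by auto
    moreover have "{n..<n + i} = (\<lambda>k. k + n) ` {..<i}"
      by (simp add: lessThan_atLeast0 add.commute)
    ultimately show ?thesis by simp
  qed
  then have "path_image c2 = outer_chain n p i j"
    using c2(4) ij by (simp add: UN_Un outer_chain_def Un_commute)
  moreover have "path_image c1 = inner_chain n p i j"
    using c1(4) ij by (simp add: inner_chain_def)
  moreover have "j + (n - (j - i)) = i + n" using ij by simp
  ultimately show ?thesis
    using that[of c1 "reversepath c2"] c1 c2 ij by (simp add: arc_reversepath)
qed

lemma chains_Int:
  assumes P: "simple_polygon n p" and ij: "i < j" "j < n"
  shows "inner_chain n p i j \<inter> outer_chain n p i j = {p i, p j}"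
proof
  show "inner_chain n p i j \<inter> outer_chain n p i j \<subseteq> {p i, p j}"
  proof
    fix x assume x: "x \<in> inner_chain n p i j \<inter> outer_chain n p i j"
    obtain k where k: "k \<in> {i..<j}" "x \<in> polygon_edge n p k"
      using x unfolding inner_chain_def by blast
    obtain l where l: "l \<in> {..<i} \<union> {j..<n}" "x \<in> polygon_edge n p l"
      using x unfolding outer_chain_def by blast
    have kl: "i \<le> k" "k < j" "l < i \<or> j \<le> l" "l < n" "k < n" "k \<noteq> l" using k l ij by auto
    obtain m where "x = p m" "m = k \<or> m = Suc k mod n" "m = l \<or> m = Suc l mod n"
      using simple_polygon_edgesD[OF P kl(5,4,6) k(2) l(2)] by blast
    moreover have "m = i \<or> m = j" if "m = k \<or> m = Suc k mod n" "m = l \<or> m = Suc l mod n"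
      using that kl ij by (auto simp: Suc_mod_if split: if_splits)
    ultimately show "x \<in> {p i, p j}" by blast
  qed
  have "p i \<in> inner_chain n p i j" "p j \<in> outer_chain n p i j"
    using vertex_in_edge(1) ij unfolding inner_chain_def outer_chain_def by fastforce+
  moreover have "p j \<in> inner_chain n p i j"
    using vertex_in_edge(2)[of p "j - 1" n] ij unfolding inner_chain_def by (auto intro!: bexI[of _ "j - 1"])
  moreover have "p i \<in> outer_chain n p i j"
  proof (cases i)
    case 0 then show ?thesis
      using vertex_in_edge(2)[of p "n - 1" n] ij unfolding outer_chain_def by (auto intro!: bexI[of _ "n - 1"])
  next
    case (Suc h) then show ?thesis
      using vertex_in_edge(2)[of p h n] ij unfolding outer_chain_def by (auto intro!: bexI[of _ h])
  qed
  ultimately show "{p i, p j} \<subseteq> inner_chain n p i j \<inter> outer_chain n p i j" by simp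
qed

text \<open>The closed curve is glued from the edge between \<open>p 0\<close> and
  \<open>p 1\<close> and the complementary chain.\<close>

lemma simple_polygon_path:
  assumes P: "simple_polygon n p"
  obtains c where "simple_path c" "pathfinish c = pathstart c" "path_image c = polygon n p"
proof -
  have n: "0 < (1::nat)" "1 < n" using P unfolding simple_polygon_def by auto
  obtain c1 c2 where c: "arc c1" "pathstart c1 = p 0" "pathfinish c1 = p 1" "path_image c1 = inner_chain n p 0 1"
    "arc c2" "pathstart c2 = p 0" "pathfinish c2 = p 1" "path_image c2 = outer_chain n p 0 1"
    using chain_arcs[OF P n] by metis
  show ?thesis
  proof
    show "simple_path (c1 +++ reversepath c2)"
      by (rule simple_path_join_loop) (use c chains_Int[OF P n] in \<open>auto simp: arc_reversepath\<close>)
    show "path_image (c1 +++ reversepath c2) = polygon n p"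
      using c polygon_eq_chains[OF n] by (simp add: path_image_join)
  qed (use c in auto)
qed

lemma Jordan_polygon:
  assumes P: "simple_polygon n p"
  shows "inside (polygon n p) \<noteq> {}" "connected (inside (polygon n p))"
    "frontier (inside (polygon n p)) = polygon n p"
  using simple_polygon_path[OF P] Jordan_real2 by metis+

text \<open>Nothing is said about the side on which the segment lies: interior diagonals and lids of
  pockets are both chords. The order of \<open>i\<close> and \<open>j\<close> fixes which chain is
  called inner.\<close>

definition chord :: "nat \<Rightarrow> (nat \<Rightarrow> real^2) \<Rightarrow> nat \<Rightarrow> nat \<Rightarrow> bool" where
  "chord n p i j \<longleftrightarrow> i < j \<and> j < n \<and> open_segment (p i) (p j) \<inter> polygon n p = {}"

text \<open>Numbers the vertices that remain when those strictly between \<open>i\<close> and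
  \<open>j\<close> are dropped: \<open>i + 1\<close> is sent to \<open>j\<close>, and the chord
  becomes edge number \<open>i\<close>.\<close>

abbreviation skip :: "nat \<Rightarrow> nat \<Rightarrow> nat \<Rightarrow> nat" where
  "skip i j k \<equiv> (if k \<le> i then k else k + (j - i) - 1)"

abbreviation inner_sub :: "(nat \<Rightarrow> real^2) \<Rightarrow> nat \<Rightarrow> nat \<Rightarrow> nat \<Rightarrow> real^2" where
  "inner_sub p i j \<equiv> p \<circ> (\<lambda>k. i + k)"

abbreviation outer_sub :: "(nat \<Rightarrow> real^2) \<Rightarrow> nat \<Rightarrow> nat \<Rightarrow> nat \<Rightarrow> real^2" where
  "outer_sub p i j \<equiv> p \<circ> skip i j"

lemma simple_polygon_inj: "simple_polygon n p \<Longrightarrow> i < n \<Longrightarrow> j < n \<Longrightarrow> p i = p j \<Longrightarrow> i = j"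
  unfolding simple_polygon_def by (meson inj_onD lessThan_iff)

text \<open>An edge of the polygon cannot avoid the polygon. Together the two inequalities give each
  polygon cut off by the chord at least three and fewer than \<open>n\<close> vertices.\<close>

lemma chord_not_adjacent:
  assumes P: "simple_polygon n p" and c: "chord n p i j"
  shows "Suc i < j" "j - i + 1 < n"
proof -
  have ij: "i < j" "j < n" and e: "open_segment (p i) (p j) \<inter> polygon n p = {}"
    using c unfolding chord_def by auto
  have "p i \<noteq> p j" using simple_polygon_inj[OF P _ ij(2), of i] ij by auto
  then have ne: "open_segment (p i) (p j) \<noteq> {}" by simp
  show "Suc i < j"
  proof (rule ccontr)
    assume "\<not> ?thesis"
    then have "j = Suc i" using ij by simp
    then have "open_segment (p i) (p j) \<subseteq> polygon n p"
      using polygon_edge_subset[of i n p] ij segment_open_subset_closed unfolding polygon_edge_def by fastforce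
    then show False using ne e by blast
  qed
  show "j - i + 1 < n"
  proof (rule ccontr)
    assume "\<not> ?thesis"
    then have "i = 0" "j = n - 1" using ij by auto
    then have "open_segment (p i) (p j) \<subseteq> polygon n p"
      using polygon_edge_subset[of j n p] ij segment_open_subset_closed[of "p i" "p j"]
      unfolding polygon_edge_def by (auto simp: closed_segment_commute)
    then show False using ne e by blast
  qed
qed

lemma inner_step:
  assumes "chord n p i j" "k < j - i + 1" "k \<noteq> j - i"
  shows "i + Suc k mod (j - i + 1) = Suc (i + k) mod n"
proof -
  have "Suc k < j - i + 1" "Suc (i + k) < n" using assms unfolding chord_def by auto
  then show ?thesis by simp
qed

lemma outer_step:
  assumes "chord n p i j" "k < n - (j - i) + 1" "k \<noteq> i"
  shows "skip i j (Suc k mod (n - (j - i) + 1)) = Suc (skip i j k) mod n"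
  using assms unfolding chord_def by (auto simp: Suc_mod_if)

lemma strict_mono_inner: "strict_mono_on {..<j - i + 1} (\<lambda>k. i + k)" for i j :: nat
  by (rule strict_mono_onI) simp

lemma strict_mono_outer: "i < j \<Longrightarrow> strict_mono_on {..<n - (j - i) + 1} (skip i j)"
  by (rule strict_mono_onI) auto

lemma inner_sub_polygon:
  assumes P: "simple_polygon n p" and c: "chord n p i j"
  shows "simple_polygon (j - i + 1) (inner_sub p i j)"
    "polygon (j - i + 1) (inner_sub p i j) = inner_chain n p i j \<union> closed_segment (p i) (p j)"
proof -
  have ij: "i < j" "j < n" using c unfolding chord_def by auto
  note adj = chord_not_adjacent[OF P c]
  note e = inner_step[OF c]
  have D: "open_segment (p (i + (j - i))) (p (i + Suc (j - i) mod (j - i + 1))) \<inter> polygon n p = {}"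
    using c ij unfolding chord_def by (simp add: open_segment_commute)
  show "simple_polygon (j - i + 1) (inner_sub p i j)"
    by (rule simple_polygon_sub[OF P _ _ _ e _ D]) (use adj ij in auto)
  have "polygon (j - i + 1) (inner_sub p i j) =
      (\<Union>k<j - i. polygon_edge (j - i + 1) (inner_sub p i j) k) \<union> polygon_edge (j - i + 1) (inner_sub p i j) (j - i)"
    by (simp add: polygon_def lessThan_Suc Un_commute)
  also have "polygon_edge (j - i + 1) (inner_sub p i j) (j - i) = closed_segment (p i) (p j)"
    using ij by (simp add: polygon_edge_def closed_segment_commute)
  also have "(\<Union>k<j - i. polygon_edge (j - i + 1) (inner_sub p i j) k) = (\<Union>k<j - i. polygon_edge n p (i + k))"
    by (intro SUP_cong refl polygon_edge_comp e) auto
  also have "\<dots> = inner_chain n p i j"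
  proof -
    have "{i..<j} = (\<lambda>k. i + k) ` {..<j - i}"
      using ij by (simp add: lessThan_atLeast0 image_add_atLeastLessThan)
    then show ?thesis unfolding inner_chain_def by simp
  qed
  finally show "polygon (j - i + 1) (inner_sub p i j) = inner_chain n p i j \<union> closed_segment (p i) (p j)" .
qed

lemma outer_sub_polygon:
  assumes P: "simple_polygon n p" and c: "chord n p i j"
  shows "simple_polygon (n - (j - i) + 1) (outer_sub p i j)"
    "polygon (n - (j - i) + 1) (outer_sub p i j) = outer_chain n p i j \<union> closed_segment (p i) (p j)"
proof -
  let ?m = "n - (j - i) + 1" and ?q = "outer_sub p i j"
  have ij: "i < j" "j < n" using c unfolding chord_def by auto
  note adj = chord_not_adjacent[OF P c]
  note e = outer_step[OF c]
  have Si: "Suc i mod ?m = Suc i" using ij by simp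
  have ski: "skip i j (Suc i) = j" using ij by simp
  have D: "open_segment (p (skip i j i)) (p (skip i j (Suc i mod ?m))) \<inter> polygon n p = {}"
    using c unfolding Si ski chord_def by simp
  show "simple_polygon ?m ?q"
  proof (rule simple_polygon_sub[OF P _ _ _ e _ D])
    show "inj_on (skip i j) {..<?m}" using ij by (auto simp: inj_on_def split: if_splits)
  qed (use adj ij in auto)
  have "{..<?m} = insert i ({..<i} \<union> {Suc i..<?m})" using ij by auto
  then have "polygon ?m ?q = polygon_edge ?m ?q i \<union> (\<Union>k\<in>{..<i} \<union> {Suc i..<?m}. polygon_edge ?m ?q k)"
    unfolding polygon_def by simp
  also have "polygon_edge ?m ?q i = closed_segment (p i) (p j)"
    using Si ski unfolding polygon_edge_def by simp
  also have "(\<Union>k\<in>{..<i} \<union> {Suc i..<?m}. polygon_edge ?m ?q k) = (\<Union>k\<in>{..<i} \<union> {Suc i..<?m}. polygon_edge n p (skip i j k))"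
    by (intro SUP_cong refl polygon_edge_comp e) (use ij in auto)
  also have "\<dots> = (\<Union>k\<in>skip i j ` ({..<i} \<union> {Suc i..<?m}). polygon_edge n p k)" by (simp only: image_image)
  also have "skip i j ` ({..<i} \<union> {Suc i..<?m}) = {..<i} \<union> {j..<n}"
  proof -
    have "{j..<n} = (\<lambda>k. k + (j - i) - 1) ` {Suc i..<?m}"
    proof
      show "{j..<n} \<subseteq> (\<lambda>k. k + (j - i) - 1) ` {Suc i..<?m}"
      proof
        fix x assume "x \<in> {j..<n}"
        then show "x \<in> (\<lambda>k. k + (j - i) - 1) ` {Suc i..<?m}"
          using ij by (intro image_eqI[of _ _ "x + 1 - (j - i)"]) auto
      qed
    qed (use ij in auto)
    moreover have "skip i j ` {..<i} = {..<i}" by force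
    moreover have "skip i j ` {Suc i..<?m} = (\<lambda>k. k + (j - i) - 1) ` {Suc i..<?m}"
      by (intro image_cong) auto
    ultimately show ?thesis by (simp only: image_Un)
  qed
  finally show "polygon ?m ?q = outer_chain n p i j \<union> closed_segment (p i) (p j)"
    unfolding outer_chain_def by (simp only: Un_commute)
qed

lemma closed_polygon: "closed (polygon n p)"
  unfolding polygon_def polygon_edge_def by (intro closed_UN) auto

lemma bounded_polygon: "bounded (polygon n p)"
  unfolding polygon_def polygon_edge_def by (intro bounded_UN ballI bounded_closed_segment) auto

lemma chord_Int_chains:
  assumes P: "simple_polygon n p" and c: "chord n p i j"
  shows "inner_chain n p i j \<inter> closed_segment (p i) (p j) = {p i, p j}"
    "outer_chain n p i j \<inter> closed_segment (p i) (p j) = {p i, p j}"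
proof -
  have ij: "i < j" "j < n" and e: "open_segment (p i) (p j) \<inter> polygon n p = {}"
    using c unfolding chord_def by auto
  have *: "closed_segment (p i) (p j) = open_segment (p i) (p j) \<union> {p i, p j}"
    by (rule closed_segment_eq_open)
  have "p i \<in> inner_chain n p i j" "p i \<in> outer_chain n p i j" "p j \<in> inner_chain n p i j" "p j \<in> outer_chain n p i j"
    using chains_Int[OF P ij] by blast+
  then show "inner_chain n p i j \<inter> closed_segment (p i) (p j) = {p i, p j}"
    "outer_chain n p i j \<inter> closed_segment (p i) (p j) = {p i, p j}"
    using e unfolding * polygon_eq_chains[OF ij] by auto
qed

text \<open>The two chains and the chord form a theta curve, and each of the three arcs in turn is
  the one that enters the inside of the other two. The first case is an interior diagonal, the other
  two are pockets.\<close>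

lemma chord_theta:
  assumes P: "simple_polygon n p" and c: "chord n p i j"
  defines "D \<equiv> closed_segment (p i) (p j)" and "A \<equiv> inner_chain n p i j" and "B \<equiv> outer_chain n p i j"
  shows chord_split: "open_segment (p i) (p j) \<inter> inside (A \<union> B) \<noteq> {} \<Longrightarrow>
      inside (A \<union> D) \<inter> inside (B \<union> D) = {} \<and>
      inside (A \<union> D) \<union> inside (B \<union> D) \<union> open_segment (p i) (p j) = inside (A \<union> B)"
    and "A \<inter> inside (D \<union> B) \<noteq> {} \<Longrightarrow>
      inside (D \<union> A) \<inter> inside (B \<union> A) = {} \<and>
      inside (D \<union> A) \<union> inside (B \<union> A) \<union> (A - {p i, p j}) = inside (D \<union> B)"
    and "B \<inter> inside (D \<union> A) \<noteq> {} \<Longrightarrow>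
      inside (D \<union> B) \<inter> inside (A \<union> B) = {} \<and>
      inside (D \<union> B) \<union> inside (A \<union> B) \<union> (B - {p i, p j}) = inside (D \<union> A)"
proof -
  have ij: "i < j" "j < n" using c unfolding chord_def by auto
  have ne: "p i \<noteq> p j" using simple_polygon_inj[OF P _ ij(2), of i] ij by auto
  obtain c1 c2 where c12: "arc c1" "pathstart c1 = p i" "pathfinish c1 = p j" "path_image c1 = A"
    "arc c2" "pathstart c2 = p i" "pathfinish c2 = p j" "path_image c2 = B"
    using chain_arcs[OF P ij] unfolding A_def B_def by metis
  let ?d = "linepath (p i) (p j)"
  have d: "simple_path ?d" "path_image ?d = D" "pathstart ?d = p i" "pathfinish ?d = p j"
    using ne by (auto simp: D_def simple_path_linepath)
  have I: "A \<inter> B = {p i, p j}" "A \<inter> D = {p i, p j}" "B \<inter> D = {p i, p j}"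
    "B \<inter> A = {p i, p j}" "D \<inter> A = {p i, p j}" "D \<inter> B = {p i, p j}"
    using chains_Int[OF P ij] chord_Int_chains[OF P c] unfolding A_def B_def D_def by auto
  note s = arc_imp_simple_path[OF c12(1)] arc_imp_simple_path[OF c12(5)]
  show "A \<inter> inside (D \<union> B) \<noteq> {} \<Longrightarrow>
      inside (D \<union> A) \<inter> inside (B \<union> A) = {} \<and>
      inside (D \<union> A) \<union> inside (B \<union> A) \<union> (A - {p i, p j}) = inside (D \<union> B)"
    using split_inside_real2[OF d(1,3,4) s(2) c12(6,7) s(1) c12(2,3) ne] I unfolding c12 d by simp
  show "B \<inter> inside (D \<union> A) \<noteq> {} \<Longrightarrow>
      inside (D \<union> B) \<inter> inside (A \<union> B) = {} \<and>
      inside (D \<union> B) \<union> inside (A \<union> B) \<union> (B - {p i, p j}) = inside (D \<union> A)"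
    using split_inside_real2[OF d(1,3,4) s(1) c12(2,3) s(2) c12(6,7) ne] I unfolding c12 d by simp
  assume "open_segment (p i) (p j) \<inter> inside (A \<union> B) \<noteq> {}"
  then have "D \<inter> inside (A \<union> B) \<noteq> {}" using segment_open_subset_closed unfolding D_def by blast
  then show "inside (A \<union> D) \<inter> inside (B \<union> D) = {} \<and>
      inside (A \<union> D) \<union> inside (B \<union> D) \<union> open_segment (p i) (p j) = inside (A \<union> B)"
    using split_inside_real2[OF s(1) c12(2,3) s(2) c12(6,7) d(1,3,4) ne] I unfolding c12 d
    by (simp add: D_def open_segment_def)
qed

section \<open>Existence of an interior chord\<close>

lemma connected_subset_inside:
  assumes "connected S" "S \<inter> P = {}" "S \<inter> inside P \<noteq> {}"
  shows "S \<subseteq> inside P"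
proof -
  obtain x where x: "x \<in> S" "x \<in> inside P" using assms(3) by blast
  then have "S \<subseteq> connected_component_set (- P) x"
    using assms by (intro connected_component_maximal) auto
  then show ?thesis using inside_same_component x by blast
qed

lemma connected_subset_outside:
  assumes "connected S" "S \<inter> P = {}" "S \<inter> outside P \<noteq> {}"
  shows "S \<subseteq> outside P"
proof -
  obtain x where x: "x \<in> S" "x \<in> outside P" using assms(3) by blast
  then have "S \<subseteq> connected_component_set (- P) x"
    using assms by (intro connected_component_maximal) auto
  then show ?thesis using outside_same_component x by blast
qed

lemma convex_comb_greater:
  fixes c :: real
  assumes "c < u" "c < v" "0 \<le> t" "t \<le> 1"
  shows "c < (1 - t) * u + t * v"
  using convex_bound_lt[of "- u" "- c" "- v" "1 - t" t] assms by simp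

text \<open>Cramer's rule for the basis \<open>d\<close>, \<open>e\<close>.\<close>

lemma plane_coordinates:
  fixes d e :: "real^2"
  assumes ne: "d $ 1 * e $ 2 \<noteq> d $ 2 * e $ 1"
  obtains f g :: "real^2 \<Rightarrow> real" where "linear f" "linear g" "\<And>x. x = f x *\<^sub>R d + g x *\<^sub>R e"
    "f d = 1" "f e = 0" "g d = 0" "g e = 1"
proof
  define D where "D = d $ 1 * e $ 2 - d $ 2 * e $ 1"
  have D: "D \<noteq> 0" using ne unfolding D_def by simp
  let ?f = "\<lambda>x::real^2. (x $ 1 * e $ 2 - x $ 2 * e $ 1) / D"
  let ?g = "\<lambda>x::real^2. (d $ 1 * x $ 2 - d $ 2 * x $ 1) / D"
  show "linear ?f" "linear ?g"
    by (rule linearI; simp add: add_divide_distrib[symmetric] diff_divide_distrib[symmetric] algebra_simps)+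
  show "?f d = 1" "?f e = 0" "?g d = 0" "?g e = 1"
    using D unfolding D_def by (simp_all add: mult.commute)
  show "x = ?f x *\<^sub>R d + ?g x *\<^sub>R e" for x
    unfolding vec_eq_iff forall_2
  proof
    have "x $ 1 * D = (x $ 1 * e $ 2 - x $ 2 * e $ 1) * d $ 1 + (d $ 1 * x $ 2 - d $ 2 * x $ 1) * e $ 1"
      "x $ 2 * D = (x $ 1 * e $ 2 - x $ 2 * e $ 1) * d $ 2 + (d $ 1 * x $ 2 - d $ 2 * x $ 1) * e $ 2"
      unfolding D_def by algebra+
    then show "x $ 1 = (?f x *\<^sub>R d + ?g x *\<^sub>R e) $ 1" "x $ 2 = (?f x *\<^sub>R d + ?g x *\<^sub>R e) $ 2"
      using D by (simp_all add: divide_simps)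
  qed
qed

text \<open>Expand the square of the norm of y + (x - y). For a vertex \<open>y\<close> of maximal
  norm this places all other vertices strictly below the tangent at \<open>y\<close> of the circle
  around 0.\<close>

lemma inner_neg_of_norm_le:
  fixes x y :: "'a::real_inner"
  assumes "norm x \<le> norm y" "x \<noteq> y"
  shows "(x - y) \<bullet> y < 0"
proof -
  have "norm x ^ 2 \<le> norm y ^ 2" using assms by (simp add: power_mono)
  moreover have "norm x ^ 2 = norm y ^ 2 + 2 * ((x - y) \<bullet> y) + norm (x - y) ^ 2"
    by (simp add: power2_norm_eq_inner algebra_simps inner_commute)
  moreover have "norm (x - y) ^ 2 > 0" using assms by simp
  ultimately show ?thesis by linarith
qed

text \<open>A vertex of maximal norm is a strictly convex corner of the polygon. We use the affine
  coordinates in which this vertex is the origin and its two neighbours are the unit vectors.\<close>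

locale polygon_corner =
  fixes n :: nat and p :: "nat \<Rightarrow> real^2" and a b c :: nat and f g :: "real^2 \<Rightarrow> real"
  assumes P: "simple_polygon n p"
    and abc: "a < n" "b = Suc a mod n" "c < n" "a = Suc c mod n"
    and max_norm: "\<And>k. k < n \<Longrightarrow> norm (p k) \<le> norm (p a)"
    and lin: "linear f" "linear g"
    and decomp: "\<And>x. x = f x *\<^sub>R (p c - p a) + g x *\<^sub>R (p b - p a)"
    and base: "f (p c - p a) = 1" "f (p b - p a) = 0" "g (p c - p a) = 0" "g (p b - p a) = 1"
begin

definition A where "A x = f (x - p a)"
definition B where "B x = g (x - p a)"

lemma n3: "n \<ge> 3" using P unfolding simple_polygon_def by blast

lemma b_less: "b < n" using abc n3 by auto

lemma distinct_abc: "a \<noteq> b" "a \<noteq> c" "b \<noteq> c"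
  using abc n3 by (auto simp: Suc_mod_if split: if_splits)

lemma A_affine: "A ((1 - t) *\<^sub>R x + t *\<^sub>R y) = (1 - t) * A x + t * A y"
proof -
  have "(1 - t) *\<^sub>R x + t *\<^sub>R y - p a = (1 - t) *\<^sub>R (x - p a) + t *\<^sub>R (y - p a)"
    by (simp add: algebra_simps)
  then show ?thesis
    unfolding A_def using lin by (simp add: linear_add linear_cmul)
qed

lemma B_affine: "B ((1 - t) *\<^sub>R x + t *\<^sub>R y) = (1 - t) * B x + t * B y"
proof -
  have "(1 - t) *\<^sub>R x + t *\<^sub>R y - p a = (1 - t) *\<^sub>R (x - p a) + t *\<^sub>R (y - p a)"
    by (simp add: algebra_simps)
  then show ?thesis
    unfolding B_def using lin by (simp add: linear_add linear_cmul)
qed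

lemma AB_vertices: "A (p a) = 0" "B (p a) = 0" "A (p b) = 0" "B (p b) = 1" "A (p c) = 1" "B (p c) = 0"
  unfolding A_def B_def using base lin by (simp_all add: linear_0)

lemma AB_decomp: "x = p a + A x *\<^sub>R (p c - p a) + B x *\<^sub>R (p b - p a)"
  unfolding A_def B_def using decomp[of "x - p a"] by (simp add: algebra_simps)

lemma AB_inj: "A x = A y \<Longrightarrow> B x = B y \<Longrightarrow> x = y"
  by (metis AB_decomp)

lemma AB_translate: "A (p a + y) = f y" "B (p a + y) = g y"
  unfolding A_def B_def by simp_all

lemma edge_a: "polygon_edge n p a = {x. A x = 0 \<and> 0 \<le> B x \<and> B x \<le> 1}"
proof (intro equalityI subsetI)
  fix x assume "x \<in> polygon_edge n p a"
  then obtain t where t: "0 \<le> t" "t \<le> 1" "x = (1 - t) *\<^sub>R p a + t *\<^sub>R p b"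
    unfolding polygon_edge_def closed_segment_def abc by blast
  then show "x \<in> {x. A x = 0 \<and> 0 \<le> B x \<and> B x \<le> 1}"
    by (simp add: A_affine B_affine AB_vertices)
next
  fix x assume x: "x \<in> {x. A x = 0 \<and> 0 \<le> B x \<and> B x \<le> 1}"
  have "x = (1 - B x) *\<^sub>R p a + B x *\<^sub>R p b"
    using AB_decomp[of x] x by (simp add: algebra_simps)
  then show "x \<in> polygon_edge n p a"
    unfolding polygon_edge_def closed_segment_def abc(2)[symmetric] using x by blast
qed

lemma edge_c: "polygon_edge n p c = {x. B x = 0 \<and> 0 \<le> A x \<and> A x \<le> 1}"
proof (intro equalityI subsetI)
  fix x assume "x \<in> polygon_edge n p c"
  then obtain t where t: "0 \<le> t" "t \<le> 1" "x = (1 - t) *\<^sub>R p c + t *\<^sub>R p a"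
    unfolding polygon_edge_def closed_segment_def abc(4)[symmetric] by blast
  then show "x \<in> {x. B x = 0 \<and> 0 \<le> A x \<and> A x \<le> 1}"
    by (simp add: A_affine B_affine AB_vertices)
next
  fix x assume x: "x \<in> {x. B x = 0 \<and> 0 \<le> A x \<and> A x \<le> 1}"
  have "x = A x *\<^sub>R p c + (1 - A x) *\<^sub>R p a"
    using AB_decomp[of x] x by (simp add: algebra_simps)
  then have "x \<in> closed_segment (p a) (p c)"
    unfolding closed_segment_def using x by (auto intro!: exI[of _ "A x"] simp: add.commute)
  then show "x \<in> polygon_edge n p c"
    unfolding polygon_edge_def abc(4)[symmetric] by (simp add: closed_segment_commute)
qed

lemma corner_not_in_edge: "k < n \<Longrightarrow> k \<noteq> a \<Longrightarrow> k \<noteq> c \<Longrightarrow> p a \<notin> polygon_edge n p k"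
  using simple_polygon_vertexD[OF P _ abc(1), of k] abc(1,3,4) n3 by (auto simp: Suc_mod_if split: if_splits)

lemma neighbour_inner_neg: "(p b - p a) \<bullet> p a < 0" "(p c - p a) \<bullet> p a < 0" "p a \<noteq> 0"
proof -
  have "p b \<noteq> p a" "p c \<noteq> p a"
    using simple_polygon_inj[OF P] abc b_less distinct_abc by metis+
  then show "(p b - p a) \<bullet> p a < 0" "(p c - p a) \<bullet> p a < 0"
    using inner_neg_of_norm_le max_norm abc b_less by blast+
  then show "p a \<noteq> 0" by auto
qed

text \<open>Close to \<open>p a\<close> the polygon consists of its two edges there. The half discs
  \<open>H1\<close> and \<open>H2\<close> overlap and avoid the polygon, and their union contains a
  point of larger norm than all vertices, so it is outside. But \<open>p a\<close> is a limit of
  inside points, and only the wedge \<open>K\<close> is left for them.\<close>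

lemma corner_inside:
  obtains e where "e > 0" "\<And>x. dist (p a) x < e \<Longrightarrow> A x > 0 \<Longrightarrow> B x > 0 \<Longrightarrow> x \<in> inside (polygon n p)"
proof -
  let ?P = "polygon n p"
  define C where "C = (\<Union>k\<in>{..<n} - {a, c}. polygon_edge n p k)"
  have "closed C" unfolding C_def polygon_edge_def by (intro closed_UN) auto
  moreover have "p a \<notin> C" unfolding C_def using corner_not_in_edge by auto
  ultimately obtain e where e: "e > 0" "ball (p a) e \<inter> C = {}"
    by (metis ComplI disjoint_eq_subset_Compl open_Compl open_contains_ball)
  have P_eq: "?P = polygon_edge n p a \<union> polygon_edge n p c \<union> C"
    unfolding polygon_def C_def using abc(1,3) by blast
  have inP: "A x = 0 \<and> 0 \<le> B x \<or> B x = 0 \<and> 0 \<le> A x" if "x \<in> ball (p a) e" "x \<in> ?P" for x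
    using that e(2) unfolding P_eq edge_a edge_c by auto
  define H1 where "H1 = ball (p a) e \<inter> {x. A x < 0}"
  define H2 where "H2 = ball (p a) e \<inter> {x. B x < 0}"
  define K where "K = ball (p a) e \<inter> {x. A x > 0 \<and> B x > 0}"
  have conv: "convex {x. A x < 0}" "convex {x. B x < 0}" "convex {x. A x > 0 \<and> B x > 0}"
  proof -
    have "(1 - t) * x + t * y < 0" if "x < 0" "y < 0" "0 \<le> t" "t \<le> 1" for x y t :: real
      using that convex_bound_lt[of x 0 y "1 - t" t] by simp
    then show "convex {x. A x < 0}" "convex {x. B x < 0}"
      unfolding convex_alt by (auto simp: A_affine B_affine)
    have "(1 - t) * x + t * y > 0" if "x > 0" "y > 0" "0 \<le> t" "t \<le> 1" for x y t :: real
      using that by (metis add_nonneg_pos add_pos_nonneg diff_ge_0_iff_ge less_eq_real_def mult_eq_0_iff mult_pos_pos mult_nonneg_nonneg right_minus_eq zero_neq_one)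
    then show "convex {x. A x > 0 \<and> B x > 0}"
      unfolding convex_alt by (auto simp: A_affine B_affine)
  qed
  have H: "connected H1" "connected H2" "connected K"
    unfolding H1_def H2_def K_def using conv by (intro convex_connected convex_Int convex_ball; simp)+
  have disj: "(H1 \<union> H2) \<inter> ?P = {}" "K \<inter> ?P = {}"
    unfolding H1_def H2_def K_def using inP by fastforce+
  have small: "\<exists>t>0. p a + t *\<^sub>R y \<in> ball (p a) e" for y :: "real^2"
  proof (cases "y = 0")
    case False
    then show ?thesis
      using e(1) by (intro exI[of _ "e / (2 * norm y)"]) (simp add: dist_norm)
  qed (use e in \<open>auto intro: exI[of _ 1]\<close>)
  have "H1 \<inter> H2 \<noteq> {}"
  proof -
    obtain t where t: "t > 0" "p a + t *\<^sub>R - ((p c - p a) + (p b - p a)) \<in> ball (p a) e"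
      using small by blast
    have "A (p a + t *\<^sub>R - ((p c - p a) + (p b - p a))) = - t" "B (p a + t *\<^sub>R - ((p c - p a) + (p b - p a))) = - t"
      unfolding AB_translate using lin base by (simp_all only: linear_cmul linear_neg linear_add, simp_all)
    then show ?thesis using t unfolding H1_def H2_def by auto
  qed
  then have conn: "connected (H1 \<union> H2)" using H connected_Un by blast
  have "(H1 \<union> H2) \<inter> outside ?P \<noteq> {}"
  proof -
    \<comment> \<open>Pushed radially outwards from \<open>p a\<close>, the point leaves the disc
      that contains the polygon.\<close>
    obtain t where t: "t > 0" "p a + t *\<^sub>R p a \<in> ball (p a) e" using small by blast
    have "?P \<subseteq> cball 0 (norm (p a))"
    proof -
      have "polygon_edge n p k \<subseteq> cball 0 (norm (p a))" if "k < n" for k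
        unfolding polygon_edge_def using that max_norm n3 by (intro closed_segment_subset) auto
      then show ?thesis unfolding polygon_def by blast
    qed
    then have "- cball 0 (norm (p a)) \<subseteq> outside ?P" by (intro outside_subset_convex) auto
    moreover have "p a + t *\<^sub>R p a = (1 + t) *\<^sub>R p a" by (simp add: algebra_simps)
    ultimately have "p a + t *\<^sub>R p a \<in> outside ?P"
      using t neighbour_inner_neg(3) by (auto simp: subset_iff)
    \<comment> \<open>Otherwise \<open>p a\<close> would be a nonnegative combination of two vectors
      whose inner products with \<open>p a\<close> are negative, although the inner product of
      \<open>p a\<close> with itself is positive.\<close>
    moreover have "f (p a) < 0 \<or> g (p a) < 0"
    proof (rule ccontr)
      assume "\<not> ?thesis"
      then have "f (p a) * ((p c - p a) \<bullet> p a) + g (p a) * ((p b - p a) \<bullet> p a) \<le> 0"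
        using neighbour_inner_neg by (intro add_nonpos_nonpos mult_nonneg_nonpos) auto
      moreover have "p a \<bullet> p a = f (p a) * ((p c - p a) \<bullet> p a) + g (p a) * ((p b - p a) \<bullet> p a)"
        by (subst (1) decomp) (simp add: inner_add_left)
      ultimately show False using neighbour_inner_neg(3) by (metis inner_gt_zero_iff not_le)
    qed
    then have "p a + t *\<^sub>R p a \<in> H1 \<union> H2"
      unfolding H1_def H2_def using t lin
      by (auto simp: AB_translate linear_cmul mult_pos_neg)
    ultimately show ?thesis by blast
  qed
  then have out: "H1 \<union> H2 \<subseteq> outside ?P" using connected_subset_outside[OF conn disj(1)] by blast
  have "p a \<in> closure (inside ?P)"
    using Jordan_polygon(3)[OF P] vertex_in_polygon[OF abc(1)] unfolding frontier_def by blast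
  then obtain x where "x \<in> inside ?P" "dist x (p a) < e"
    using e(1) closure_approachable by blast
  then have x: "x \<in> inside ?P" "x \<in> ball (p a) e" by (simp_all add: dist_commute)
  have "x \<notin> ?P" "x \<notin> outside ?P" using x(1) by (auto simp: inside_def outside_def)
  then have AB: "A x \<ge> 0" "B x \<ge> 0" using x(2) out unfolding H1_def H2_def by fastforce+
  \<comment> \<open>\<open>p b\<close> and \<open>p c\<close> lie on further edges, hence not in the
    small disc; so a point of the disc on a nonnegative half-axis lies on the edge itself.\<close>
  have far: "e \<le> dist (p a) (p b)" "e \<le> dist (p a) (p c)"
  proof -
    have "p b \<in> polygon_edge n p b" by (rule vertex_in_edge)
    then have "p b \<in> C" unfolding C_def using b_less distinct_abc by blast
    then show "e \<le> dist (p a) (p b)" using e(2) by (meson disjoint_iff mem_ball not_le)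
    define h where "h = (if c = 0 then n - 1 else c - 1)"
    have h: "h < n" "c = Suc h mod n" using abc(3) n3 unfolding h_def by auto
    have "p c \<in> polygon_edge n p h" using vertex_in_edge(2) h(2) by simp
    moreover have "h \<noteq> a" "h \<noteq> c" using h abc n3 distinct_abc by (auto simp: Suc_mod_if split: if_splits)
    ultimately have "p c \<in> C" unfolding C_def using h by blast
    then show "e \<le> dist (p a) (p c)" using e(2) by (meson disjoint_iff mem_ball not_le)
  qed
  have "A x \<noteq> 0"
  proof
    assume A0: "A x = 0"
    then have "x - p a = B x *\<^sub>R (p b - p a)" using AB_decomp[of x] by (simp add: algebra_simps)
    then have "dist (p a) x = B x * dist (p a) (p b)" using AB by (simp add: dist_norm norm_minus_commute)
    then have "B x * dist (p a) (p b) < 1 * dist (p a) (p b)" using x(2) far by simp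
    then have "B x < 1" by (rule mult_right_less_imp_less) simp
    then have "x \<in> polygon_edge n p a" unfolding edge_a using A0 AB by simp
    then show False using \<open>x \<notin> ?P\<close> polygon_edge_subset abc by blast
  qed
  moreover have "B x \<noteq> 0"
  proof
    assume B0: "B x = 0"
    then have "x - p a = A x *\<^sub>R (p c - p a)" using AB_decomp[of x] by (simp add: algebra_simps)
    then have "dist (p a) x = A x * dist (p a) (p c)" using AB by (simp add: dist_norm norm_minus_commute)
    then have "A x * dist (p a) (p c) < 1 * dist (p a) (p c)" using x(2) far by simp
    then have "A x < 1" by (rule mult_right_less_imp_less) simp
    then have "x \<in> polygon_edge n p c" unfolding edge_c using B0 AB by simp
    then show False using \<open>x \<notin> ?P\<close> polygon_edge_subset abc by blast
  qed
  ultimately have "x \<in> K" unfolding K_def using AB x(2) by auto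
  then have "K \<subseteq> inside ?P" using connected_subset_inside[OF H(3) disj(2)] x(1) by blast
  then have "x \<in> inside ?P" if "dist (p a) x < e" "A x > 0" "B x > 0" for x
    using that unfolding K_def by auto
  then show ?thesis using that[OF e(1)] by blast
qed

text \<open>By the intermediate value theorem the edge has a point with min(A, B) = 0 between
  \<open>q\<close> and \<open>x\<close>. There A + B < 1, so the point is on one of the two edges at
  \<open>p a\<close> but is neither \<open>p b\<close> nor \<open>p c\<close>. Edges meet in common
  vertices only, which leaves \<open>p a\<close>, and edge \<open>k\<close> does not contain
  it.\<close>

lemma no_edge_enters_through_sides:
  assumes k: "k < n" "k \<noteq> a" "k \<noteq> c" and q: "q \<in> polygon_edge n p k" "A q > 0" "B q > 0" "A q + B q \<le> 1"
    and x: "x \<in> polygon_edge n p k" "A x < 0 \<or> B x < 0" "A x + B x < 1"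
  shows False
proof -
  let ?r = "\<lambda>t. (1 - t) *\<^sub>R q + t *\<^sub>R x"
  have "continuous_on {0..1} (\<lambda>t. min ((1 - t) * A q + t * A x) ((1 - t) * B q + t * B x))"
    by (intro continuous_intros)
  then obtain t where t: "0 \<le> t" "t \<le> 1" "min (A (?r t)) (B (?r t)) = 0"
    unfolding A_affine B_affine
    using IVT2'[of "\<lambda>t. min ((1 - t) * A q + t * A x) ((1 - t) * B q + t * B x)" 1 0 0] q x
    by (auto simp: min_le_iff_disj less_imp_le)
  have "t \<noteq> 0" using t(3) q by auto
  then have "(1 - t) * (A q + B q) + t * (A x + B x) < 1"
    using t q x by (smt (verit, best) mult_left_le mult_less_cancel_left2 mult_right_mono)
  then have less: "A (?r t) + B (?r t) < 1" unfolding A_affine B_affine by (simp add: algebra_simps)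
  have rk: "?r t \<in> polygon_edge n p k"
    using q(1) x(1) t(1,2) convex_closed_segment unfolding polygon_edge_def convex_alt by blast
  have "?r t \<in> polygon_edge n p a \<or> ?r t \<in> polygon_edge n p c"
    unfolding edge_a edge_c using t(3) less by (auto simp: min_def split: if_splits)
  then obtain m where m: "m < n" "?r t = p m" "m = a \<or> m = b \<or> m = c"
  proof
    assume "?r t \<in> polygon_edge n p a"
    then obtain m where "?r t = p m" "m = a \<or> m = Suc a mod n"
      using simple_polygon_edgesD[OF P k(1) abc(1) k(2) rk] by metis
    then show thesis using that abc b_less by blast
  next
    assume "?r t \<in> polygon_edge n p c"
    then obtain m where "?r t = p m" "m = c \<or> m = Suc c mod n"
      using simple_polygon_edgesD[OF P k(1) abc(3) k(3) rk] by metis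
    then show thesis using that abc b_less by blast
  qed
  then show False using less AB_vertices rk corner_not_in_edge[OF k] by auto
qed

text \<open>The classical choice of a diagonal at a convex corner: if the triangle on
  \<open>p a\<close>, \<open>p b\<close>, \<open>p c\<close> contains further vertices, join
  \<open>p a\<close> to the one farthest from the line through \<open>p b\<close> and
  \<open>p c\<close>; otherwise join \<open>p b\<close> to \<open>p c\<close>.\<close>

lemma exists_inside_segment:
  assumes n: "n \<ge> 4"
  shows "\<exists>i<n. \<exists>j<n. i \<noteq> j \<and> open_segment (p i) (p j) \<subseteq> inside (polygon n p)"
proof -
  let ?P = "polygon n p"
  define S where "S = {m. m < n \<and> m \<notin> {a, b, c} \<and> A (p m) \<ge> 0 \<and> B (p m) \<ge> 0 \<and> A (p m) + B (p m) \<le> 1}"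
  obtain e where e: "e > 0" "\<And>x. dist (p a) x < e \<Longrightarrow> A x > 0 \<Longrightarrow> B x > 0 \<Longrightarrow> x \<in> inside ?P"
    using corner_inside by blast
  have V: "m = a \<or> m = b \<or> m = c \<or> m \<in> S" if "m < n" "A (p m) \<ge> 0" "B (p m) \<ge> 0" "A (p m) + B (p m) \<le> 1" for m
    using that unfolding S_def by blast
  have edge_cases: False if q: "q \<in> ?P" "A q > 0" "B q > 0"
    and *: "\<And>k. k < n \<Longrightarrow> k \<noteq> a \<Longrightarrow> k \<noteq> c \<Longrightarrow> q \<in> polygon_edge n p k \<Longrightarrow> False" for q
  proof -
    obtain k where k: "k < n" "q \<in> polygon_edge n p k" using q(1) unfolding polygon_def by blast
    moreover have "k \<noteq> a" "k \<noteq> c" using k(2) q edge_a edge_c by auto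
    ultimately show False using * by blast
  qed
  have near: "\<exists>t. 0 < t \<and> t < 1 \<and> dist (p a) (p a + t *\<^sub>R y) < e" for y :: "real^2"
  proof -
    let ?s = "e / (2 * (norm y + 1))"
    have n1: "norm y + 1 > 0" by (simp add: add_nonneg_pos)
    then have s: "?s > 0" using e(1) by simp
    have "?s * norm y \<le> ?s * (norm y + 1)" using s by (intro mult_left_mono) auto
    also have "\<dots> = e / 2" using n1 by (simp add: field_simps)
    finally have "?s * norm y < e" using e(1) by linarith
    moreover have "min (1/2) ?s * norm y \<le> ?s * norm y" by (intro mult_right_mono) auto
    ultimately show ?thesis
      using s by (intro exI[of _ "min (1/2) ?s"]) (simp add: dist_norm)
  qed
  show ?thesis
  proof (cases "S = {}")
    case False
    have "finite S" unfolding S_def by simp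
    \<comment> \<open>A + B is 0 at \<open>p a\<close> and 1 on the opposite side, so minimality
      means largest distance from that side.\<close>
    define m where "m = arg_min_on (\<lambda>m. A (p m) + B (p m)) S"
    have m: "m \<in> S" using arg_min_if_finite[OF \<open>finite S\<close> False] unfolding m_def by blast
    have min: "A (p m) + B (p m) \<le> A (p h) + B (p h)" if "h \<in> S" for h
      using arg_min_least[OF \<open>finite S\<close> False that, of "\<lambda>m. A (p m) + B (p m)"] unfolding m_def by simp
    have mS: "m < n" "m \<noteq> a" "m \<noteq> b" "m \<noteq> c" "A (p m) \<ge> 0" "B (p m) \<ge> 0" "A (p m) + B (p m) \<le> 1"
      using m unfolding S_def by auto
    \<comment> \<open>A vertex of the closed triangle with a zero coordinate would lie on an edge at
      \<open>p a\<close>.\<close>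
    have "A (p m) \<noteq> 0"
      using simple_polygon_vertexD[OF P abc(1) mS(1)] mS abc(2) unfolding edge_a by auto
    moreover have "B (p m) \<noteq> 0"
      using simple_polygon_vertexD[OF P abc(3) mS(1)] mS abc(4) unfolding edge_c by auto
    ultimately have pos: "A (p m) > 0" "B (p m) > 0" using mS by auto
    have seg: "A x > 0 \<and> B x > 0 \<and> A x + B x < A (p m) + B (p m)" if x: "x \<in> open_segment (p a) (p m)" for x
    proof -
      obtain t where t: "0 < t" "t < 1" "x = (1 - t) *\<^sub>R p a + t *\<^sub>R p m"
        using x unfolding in_segment by blast
      have "A x = t * A (p m)" "B x = t * B (p m)"
        unfolding t A_affine B_affine AB_vertices by auto
      moreover have "t * (A (p m) + B (p m)) < A (p m) + B (p m)"
        using t pos by (simp add: mult_less_cancel_right1)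
      ultimately show ?thesis using t(1,2) pos by (simp add: distrib_left)
    qed
    have disj: "open_segment (p a) (p m) \<inter> ?P = {}"
    proof (rule ccontr)
      assume "\<not> ?thesis"
      then obtain q where q: "q \<in> open_segment (p a) (p m)" "q \<in> ?P" by blast
      note s = seg[OF q(1)]
      show False
      proof (rule edge_cases[OF q(2)])
        fix k assume k: "k < n" "k \<noteq> a" "k \<noteq> c" "q \<in> polygon_edge n p k"
        \<comment> \<open>An end with so small a value of A + B is not in \<open>S\<close>, by the
          choice of \<open>m\<close>, so it has a negative coordinate and the edge would enter
          through a side at \<open>p a\<close>. As A + B is affine along edge \<open>k\<close>, one
          of the ends does have a value no larger than that at \<open>q\<close>.\<close>
        have far_end: False if h: "h = k \<or> h = Suc k mod n" and le: "A (p h) + B (p h) \<le> A q + B q" for h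
        proof -
          have h': "p h \<in> polygon_edge n p k" "h < n" using h vertex_in_edge k n by auto
          have "A (p h) < 0 \<or> B (p h) < 0"
          proof (rule ccontr)
            assume "\<not> ?thesis"
            then have "h = a \<or> h = b \<or> h = c \<or> h \<in> S" using V[OF h'(2)] le s mS by simp
            then show False
              using min le s mS AB_vertices corner_not_in_edge[OF k(1-3)] h' by force
          qed
          then show False
            using no_edge_enters_through_sides[OF k(1-3) k(4) _ _ _ h'(1)] s le mS by linarith
        qed
        obtain t where t: "0 \<le> t" "t \<le> 1" "q = (1 - t) *\<^sub>R p k + t *\<^sub>R p (Suc k mod n)"
          using k(4) unfolding polygon_edge_def in_segment by blast
        let ?u = "A (p k) + B (p k)" and ?v = "A (p (Suc k mod n)) + B (p (Suc k mod n))"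
        have "A q + B q = (1 - t) * ?u + t * ?v"
          unfolding t(3) A_affine B_affine by (simp add: algebra_simps)
        then have "?u \<le> A q + B q \<or> ?v \<le> A q + B q"
          using convex_comb_greater[of "A q + B q" ?u ?v t] t(1,2) by (metis less_irrefl not_le)
        then show False using far_end by blast
      qed (use s in auto)
    qed
    have "open_segment (p a) (p m) \<inter> inside ?P \<noteq> {}"
    proof -
      obtain t where t: "0 < t" "t < 1" "dist (p a) (p a + t *\<^sub>R (p m - p a)) < e" using near by blast
      have "p a \<noteq> p m" using simple_polygon_inj[OF P] abc mS by metis
      then have x: "p a + t *\<^sub>R (p m - p a) \<in> open_segment (p a) (p m)"
        using t unfolding in_segment by (auto intro!: exI[of _ t] simp: algebra_simps)
      then show ?thesis using e(2)[OF t(3)] seg[OF x] by blast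
    qed
    then have "open_segment (p a) (p m) \<subseteq> inside ?P"
      by (rule connected_subset_inside[OF convex_connected[OF convex_open_segment] disj])
    then show ?thesis using mS abc by blast
  next
    case True
    let ?T = "{x. A x > 0 \<and> B x > 0 \<and> A x + B x < 1}"
    \<comment> \<open>With no further vertex in the triangle, an end with A + B < 1 has a negative
      coordinate. So an edge that reaches the triangle off its sides at \<open>p a\<close> has both
      ends on or beyond the line A + B = 1.\<close>
    have far_end: "\<not> A (p h) + B (p h) < 1" if k: "k < n" "k \<noteq> a" "k \<noteq> c" "q \<in> polygon_edge n p k"
      and q: "A q > 0" "B q > 0" "A q + B q \<le> 1" and h: "h = k \<or> h = Suc k mod n" for k q h
    proof
      assume less: "A (p h) + B (p h) < 1"
      have h': "p h \<in> polygon_edge n p k" "h < n" using h vertex_in_edge k n by auto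
      have "A (p h) < 0 \<or> B (p h) < 0"
        using V[OF h'(2)] True less AB_vertices corner_not_in_edge[OF k(1-3)] h' by force
      then show False using no_edge_enters_through_sides[OF k q h'(1)] less by blast
    qed
    have sum_q: "\<exists>t. 0 \<le> t \<and> t \<le> 1 \<and> q = (1 - t) *\<^sub>R p k + t *\<^sub>R p (Suc k mod n) \<and>
        A q + B q = (1 - t) * (A (p k) + B (p k)) + t * (A (p (Suc k mod n)) + B (p (Suc k mod n)))"
      if q: "q \<in> polygon_edge n p k" for q k
    proof -
      obtain t where t: "0 \<le> t" "t \<le> 1" "q = (1 - t) *\<^sub>R p k + t *\<^sub>R p (Suc k mod n)"
        using q unfolding polygon_edge_def in_segment by blast
      have "A q + B q = (1 - t) * (A (p k) + B (p k)) + t * (A (p (Suc k mod n)) + B (p (Suc k mod n)))"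
        unfolding t(3) A_affine B_affine by (simp add: algebra_simps)
      then show ?thesis using t by blast
    qed
    have disjT: "?T \<inter> ?P = {}"
    proof (rule ccontr)
      assume "\<not> ?thesis"
      then obtain q where q: "A q > 0" "B q > 0" "A q + B q < 1" "q \<in> ?P" by blast
      show False
      proof (rule edge_cases[OF q(4,1,2)])
        fix k assume k: "k < n" "k \<noteq> a" "k \<noteq> c" "q \<in> polygon_edge n p k"
        have *: "A (p k) + B (p k) \<ge> 1" "A (p (Suc k mod n)) + B (p (Suc k mod n)) \<ge> 1"
          using far_end[OF k q(1,2)] q(3) by force+
        obtain t where t: "0 \<le> t" "t \<le> 1" "A q + B q = (1 - t) * (A (p k) + B (p k)) + t * (A (p (Suc k mod n)) + B (p (Suc k mod n)))"
          using sum_q[OF k(4)] by blast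
        have "(1 - t) * 1 + t * 1 \<le> A q + B q"
          unfolding t(3) using t * by (intro add_mono mult_left_mono) auto
        then show False using q by simp
      qed
    qed
    have "convex ?T"
    proof -
      have eq: "?T = {x. f x > f (p a)} \<inter> {x. g x > g (p a)} \<inter> {x. f x + g x < 1 + f (p a) + g (p a)}"
        unfolding A_def B_def using lin by (auto simp: linear_diff)
      have "linear (\<lambda>x. f x + g x)" using lin by (rule linear_compose_add)
      then have "convex (f -` {f (p a)<..})" "convex (g -` {g (p a)<..})"
        "convex ((\<lambda>x. f x + g x) -` {..<1 + f (p a) + g (p a)})"
        using lin by (intro convex_linear_vimage; simp)+
      then show ?thesis unfolding eq vimage_def by (intro convex_Int) auto
    qed
    have T_inside: "?T \<subseteq> inside ?P"
    proof -
      let ?y = "(1/3) *\<^sub>R (p c - p a) + (1/3) *\<^sub>R (p b - p a)"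
      obtain t where t: "0 < t" "t < 1" "dist (p a) (p a + t *\<^sub>R ?y) < e" using near by blast
      have "A (p a + t *\<^sub>R ?y) = t / 3" "B (p a + t *\<^sub>R ?y) = t / 3"
        unfolding AB_translate using lin base by (simp_all add: linear_cmul linear_add)
      then have "p a + t *\<^sub>R ?y \<in> ?T" "p a + t *\<^sub>R ?y \<in> inside ?P" using t e by auto
      then show ?thesis
        using connected_subset_inside[OF convex_connected[OF \<open>convex ?T\<close>] disjT] by blast
    qed
    have side: "A x > 0 \<and> B x > 0 \<and> A x + B x = 1" if x: "x \<in> open_segment (p b) (p c)" for x
    proof -
      obtain t where t: "0 < t" "t < 1" "x = (1 - t) *\<^sub>R p b + t *\<^sub>R p c"
        using x unfolding in_segment by blast
      show ?thesis unfolding t A_affine B_affine AB_vertices using t by auto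
    qed
    have "x \<in> inside ?P" if x: "x \<in> open_segment (p b) (p c)" for x
    proof -
      note s = side[OF x]
      have "x \<notin> ?P"
      proof
        assume "x \<in> ?P"
        then show False
        proof (rule edge_cases)
          fix k assume k: "k < n" "k \<noteq> a" "k \<noteq> c" "x \<in> polygon_edge n p k"
          let ?k = "Suc k mod n"
          have k': "?k < n" using k n by simp
          have *: "A (p k) + B (p k) \<ge> 1" "A (p ?k) + B (p ?k) \<ge> 1"
            using far_end[OF k, of k] far_end[OF k, of ?k] s by force+
          obtain t where t: "0 \<le> t" "t \<le> 1" "x = (1 - t) *\<^sub>R p k + t *\<^sub>R p ?k"
            "A x + B x = (1 - t) * (A (p k) + B (p k)) + t * (A (p ?k) + B (p ?k))"
            using sum_q[OF k(4)] by blast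
          have not_open: "A (p h) \<le> 0 \<or> B (p h) \<le> 0" if "h < n" "A (p h) + B (p h) = 1" for h
            using V[OF that(1)] True AB_vertices that(2) by force
          have x_ne: "x \<noteq> p h" if "h < n" for h using not_open[OF that] s by auto
          have t01: "0 < t" "t < 1"
            using x_ne[OF k(1)] x_ne[OF k'] t by (auto simp: less_le)
          have "(1 - t) * (A (p k) + B (p k) - 1) + t * (A (p ?k) + B (p ?k) - 1) = 0"
            using t(4) s by (simp add: algebra_simps)
          moreover have "(1 - t) * (A (p k) + B (p k) - 1) \<ge> 0" "t * (A (p ?k) + B (p ?k) - 1) \<ge> 0"
            using t01 * by simp_all
          ultimately have "(1 - t) * (A (p k) + B (p k) - 1) = 0" "t * (A (p ?k) + B (p ?k) - 1) = 0"
            by linarith+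
          \<comment> \<open>The whole edge therefore lies on the line A + B = 1. No vertex lies
            strictly between \<open>p b\<close> and \<open>p c\<close>, so the edge covers both of
            them; they are then its two ends, which is possible only for n = 3.\<close>
          then have one: "A (p k) + B (p k) = 1" "A (p ?k) + B (p ?k) = 1"
            using t01 by auto
          have Ax: "A x = (1 - t) * A (p k) + t * A (p ?k)" "B x = (1 - t) * B (p k) + t * B (p ?k)"
            unfolding t(3) A_affine B_affine by auto
          have on_line: "p h \<in> polygon_edge n p k" if "0 \<le> s" "s \<le> 1" "A (p h) = (1 - s) * A (p k) + s * A (p ?k)"
              "A (p h) + B (p h) = 1" for h s
          proof -
            let ?y = "(1 - s) *\<^sub>R p k + s *\<^sub>R p ?k"
            have "A ?y = A (p h)" unfolding A_affine using that by simp
            moreover have "B ?y = B (p h)"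
            proof -
              have "A ?y + B ?y = (1 - s) * (A (p k) + B (p k)) + s * (A (p ?k) + B (p ?k))"
                unfolding A_affine B_affine by (simp add: algebra_simps)
              then have "A ?y + B ?y = 1" unfolding one by simp
              then show ?thesis using \<open>A ?y = A (p h)\<close> that(4) by linarith
            qed
            ultimately have "?y = p h" by (rule AB_inj)
            then show ?thesis unfolding polygon_edge_def in_segment using that by metis
          qed
          have btw: "\<exists>s. 0 \<le> s \<and> s \<le> 1 \<and> z = (1 - s) * y1 + s * y2"
            if "y1 \<le> z \<and> z \<le> y2 \<or> y2 \<le> z \<and> z \<le> y1" for z y1 y2 :: real
          proof -
            have "z \<in> closed_segment y1 y2" using that by (auto simp: closed_segment_eq_real_ivl)
            then show ?thesis unfolding in_segment by auto
          qed
          have "A (p k) \<le> 0 \<and> 1 \<le> A (p ?k) \<or> A (p ?k) \<le> 0 \<and> 1 \<le> A (p k)"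
          proof -
            have nonpos: "(1 - t) * u + t * v \<le> 0" if "u \<le> 0" "v \<le> 0" for u v
              using t01 that by (intro add_nonpos_nonpos mult_nonneg_nonpos) auto
            have "A (p k) \<le> 0 \<or> 1 \<le> A (p k)" "A (p ?k) \<le> 0 \<or> 1 \<le> A (p ?k)"
              using not_open[OF k(1) one(1)] not_open[OF k' one(2)] one by linarith+
            moreover have "\<not> (A (p k) \<le> 0 \<and> A (p ?k) \<le> 0)"
              using nonpos[of "A (p k)" "A (p ?k)"] s Ax(1) by linarith
            moreover have "\<not> (B (p k) \<le> 0 \<and> B (p ?k) \<le> 0)"
              using nonpos[of "B (p k)" "B (p ?k)"] s Ax(2) by linarith
            ultimately show ?thesis using one by linarith
          qed
          then have cases: "A (p k) \<le> z \<and> z \<le> A (p ?k) \<or> A (p ?k) \<le> z \<and> z \<le> A (p k)" if "0 \<le> z" "z \<le> 1" for z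
            using that by linarith
          have "p b \<in> polygon_edge n p k" "p c \<in> polygon_edge n p k"
            using btw[OF cases, of "A (p b)"] btw[OF cases, of "A (p c)"] on_line AB_vertices by auto
          then have "b = k \<or> b = ?k" "c = k \<or> c = ?k"
            using simple_polygon_vertexD[OF P k(1)] b_less abc by blast+
          then show False
            using k distinct_abc abc n by (auto simp: Suc_mod_if split: if_splits)
        qed (use s in auto)
      qed
      \<comment> \<open>Points of the side are limits of points of the open triangle
        \<open>?T\<close>; being off the frontier of the inside, they belong to it.\<close>
      moreover have "x \<in> closure (inside ?P)"
      proof -
        have "(1 - t) *\<^sub>R x + t *\<^sub>R p a \<in> inside ?P" if t: "0 < t" "t < 1" for t
        proof -
          have "(1 - t) * A x + (1 - t) * B x < 1"
            using s t by (simp add: distrib_left[symmetric])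
          then show ?thesis
            using T_inside s t by (intro subsetD[OF T_inside]) (simp add: A_affine B_affine AB_vertices)
        qed
        then have sub: "open_segment x (p a) \<subseteq> inside ?P" by (auto simp: in_segment)
        have "x \<noteq> p a" using s AB_vertices by auto
        then have "x \<in> closure (open_segment x (p a))" by simp
        then show ?thesis using closure_mono[OF sub] by blast
      qed
      ultimately show ?thesis
        using Jordan_polygon(3)[OF P] unfolding frontier_def interior_open[OF open_inside[OF closed_polygon]] by blast
    qed
    then show ?thesis using b_less abc distinct_abc by blast
  qed
qed

end

lemma parallel_vectors:
  fixes d e :: "real^2"
  assumes "e \<noteq> 0" and cross: "d $ 1 * e $ 2 = d $ 2 * e $ 1"
  shows "\<exists>t. d = t *\<^sub>R e"
proof (cases "e $ 1 = 0")
  case True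
  then have "e $ 2 \<noteq> 0" using \<open>e \<noteq> 0\<close> by (simp add: vec_eq_iff forall_2)
  then have "d = (d $ 2 / e $ 2) *\<^sub>R e"
    using True cross by (simp add: vec_eq_iff forall_2)
  then show ?thesis by blast
next
  case False
  then have "d = (d $ 1 / e $ 1) *\<^sub>R e"
    using cross by (simp add: vec_eq_iff forall_2 field_simps)
  then show ?thesis by blast
qed

text \<open>What has to be excluded is that the two edges at a vertex of maximal norm are parallel.
  Both point below the tangent there, so parallel edges would run in the same direction, and one
  neighbour would lie on the edge towards the other.\<close>

lemma exists_polygon_corner:
  assumes P: "simple_polygon n p"
  shows "\<exists>a b c f g. polygon_corner n p a b c f g"
proof -
  have n: "n \<ge> 3" using P unfolding simple_polygon_def by blast
  define a where "a = arg_min_on (\<lambda>k. - norm (p k)) {..<n}"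
  have ne: "finite {..<n}" "{..<n} \<noteq> {}" using n by (auto simp: lessThan_empty_iff)
  have a: "a < n" using arg_min_if_finite(1)[OF ne] unfolding a_def by blast
  have max: "norm (p k) \<le> norm (p a)" if "k < n" for k
    using arg_min_least[OF ne, of k "\<lambda>k. - norm (p k)"] that unfolding a_def by simp
  define b where "b = Suc a mod n"
  define c where "c = (if a = 0 then n - 1 else a - 1)"
  have c: "c < n" "a = Suc c mod n" using a n unfolding c_def by auto
  have b: "b < n" using n unfolding b_def by simp
  have distinct: "a \<noteq> b" "a \<noteq> c" "b \<noteq> c"
    using a n unfolding b_def c_def by (auto simp: Suc_mod_if split: if_splits)
  let ?d = "p c - p a" and ?e = "p b - p a"
  have "p b \<noteq> p a" "p c \<noteq> p a"
    using simple_polygon_inj[OF P] a b c distinct by metis+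
  then have negs: "?d \<bullet> p a < 0" "?e \<bullet> p a < 0" using inner_neg_of_norm_le max b c by blast+
  have "?d $ 1 * ?e $ 2 \<noteq> ?d $ 2 * ?e $ 1"
  proof
    assume cross: "?d $ 1 * ?e $ 2 = ?d $ 2 * ?e $ 1"
    obtain t where t: "?d = t *\<^sub>R ?e"
      using parallel_vectors[OF _ cross] \<open>p b \<noteq> p a\<close> by auto
    have "?d \<bullet> p a = t * (?e \<bullet> p a)" by (subst t) simp
    then have tpos: "t > 0" using negs by (metis mult_nonpos_nonpos not_le less_imp_le)
    show False
    proof (cases "t \<le> 1")
      case True
      have "p c = (1 - t) *\<^sub>R p a + t *\<^sub>R p b" using t by (simp add: algebra_simps)
      then have "p c \<in> polygon_edge n p a"
        unfolding polygon_edge_def in_segment b_def[symmetric] using True tpos by (metis less_imp_le)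
      then show False using simple_polygon_vertexD[OF P a c(1)] distinct b_def by auto
    next
      case False
      have "?e = (1 / t) *\<^sub>R ?d" by (subst t) (use tpos in simp)
      then have "p b = (1 - (1 - 1 / t)) *\<^sub>R p c + (1 - 1 / t) *\<^sub>R p a" by (simp add: algebra_simps)
      moreover have "0 \<le> 1 - 1 / t" "1 - 1 / t \<le> 1" using False tpos by auto
      ultimately have "p b \<in> polygon_edge n p c"
        unfolding polygon_edge_def in_segment c(2)[symmetric] by metis
      then show False using simple_polygon_vertexD[OF P c(1) b] distinct c by auto
    qed
  qed
  then obtain f g :: "real^2 \<Rightarrow> real" where fg: "linear f" "linear g" "\<And>x. x = f x *\<^sub>R ?d + g x *\<^sub>R ?e"
    "f ?d = 1" "f ?e = 0" "g ?d = 0" "g ?e = 1"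
    using plane_coordinates by metis
  have "polygon_corner n p a b c f g"
    by (rule polygon_corner.intro[OF P a b_def c max fg])
  then show ?thesis by blast
qed

lemma exists_interior_chord:
  assumes P: "simple_polygon n p" and n: "n \<ge> 4"
  obtains i j where "chord n p i j" "open_segment (p i) (p j) \<subseteq> inside (polygon n p)"
proof -
  obtain a b c f g where "polygon_corner n p a b c f g" using exists_polygon_corner[OF P] by blast
  then interpret polygon_corner n p a b c f g .
  obtain i j where ij: "i < n" "j < n" "i \<noteq> j" "open_segment (p i) (p j) \<subseteq> inside (polygon n p)"
    using exists_inside_segment[OF n] by blast
  then have "open_segment (p i) (p j) \<inter> polygon n p = {}" by (auto simp: inside_def)
  then show ?thesis
    using ij that[of i j] that[of j i] unfolding chord_def by (metis linorder_neqE_nat open_segment_commute)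
qed

section \<open>Triangulation of the interior\<close>

text \<open>A cell is a triangle on vertices of the polygon whose interior and whose sides other than
  edges of the polygon lie in the region \<open>R\<close>, which is the interior or the exterior.\<close>

definition cell :: "nat \<Rightarrow> (nat \<Rightarrow> real^2) \<Rightarrow> (real^2) set \<Rightarrow> nat set \<Rightarrow> bool" where
  "cell n p R I \<longleftrightarrow> I \<subseteq> {..<n} \<and> card I = 3 \<and> \<not> collinear (p ` I) \<and> interior (convex hull (p ` I)) \<subseteq> R \<and>
     (\<forall>i\<in>I. \<forall>j\<in>I. i \<noteq> j \<longrightarrow> open_segment (p i) (p j) \<subseteq> R \<or> j = Suc i mod n \<or> i = Suc j mod n)"

lemma open_segment_subset_edge:
  assumes "i < n" "j < n" "j = Suc i mod n \<or> i = Suc j mod n"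
  shows "open_segment (p i) (p j) \<subseteq> polygon n p"
proof -
  have "open_segment (p i) (p j) \<subseteq> polygon_edge n p i \<or> open_segment (p i) (p j) \<subseteq> polygon_edge n p j"
    using assms(3) segment_open_subset_closed[of "p i" "p j"] unfolding polygon_edge_def
    by (auto simp: closed_segment_commute)
  then show ?thesis using assms polygon_edge_subset by blast
qed

text \<open>A side of the cell that was an edge of the smaller polygon is either an edge of the
  large one or the chord, and the chord lies in \<open>R\<close>.\<close>

lemma cell_sub:
  assumes c: "cell m (p \<circ> s) R' I" and s: "inj_on s {..<m}" "s ` {..<m} \<subseteq> {..<n}" and R: "R' \<subseteq> R"
    and e: "\<And>k. k < m \<Longrightarrow> k \<noteq> d \<Longrightarrow> s (Suc k mod m) = Suc (s k) mod n"
    and D: "open_segment (p (s d)) (p (s (Suc d mod m))) \<subseteq> R"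
  shows "cell n p R (s ` I)"
proof -
  have I: "I \<subseteq> {..<m}" "card I = 3" "\<not> collinear (p ` s ` I)" "interior (convex hull (p ` s ` I)) \<subseteq> R'"
    using c unfolding cell_def by (auto simp: image_comp)
  have "card (s ` I) = 3" using I s by (metis card_image inj_on_subset)
  moreover have side: "open_segment (p (s i)) (p (s j)) \<subseteq> R \<or> s j = Suc (s i) mod n \<or> s i = Suc (s j) mod n"
    if "i \<in> I" "j \<in> I" "s i \<noteq> s j" for i j
  proof -
    have "i \<noteq> j" using that by blast
    then have "open_segment ((p \<circ> s) i) ((p \<circ> s) j) \<subseteq> R' \<or> j = Suc i mod m \<or> i = Suc j mod m"
      using c that unfolding cell_def by blast
    then consider "open_segment (p (s i)) (p (s j)) \<subseteq> R'" | "j = Suc i mod m" | "i = Suc j mod m"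
      by (simp only: comp_apply) blast
    then show ?thesis
    proof cases
      case 1 then show ?thesis using R by blast
    next
      case 2 then show ?thesis using e[of i] D I(1) that by (cases "i = d") auto
    next
      case 3 then show ?thesis using e[of j] D I(1) that
        by (cases "j = d") (auto simp: open_segment_commute)
    qed
  qed
  moreover have "s ` I \<subseteq> {..<n}" using I(1) s(2) by blast
  moreover have "\<forall>i\<in>s ` I. \<forall>j\<in>s ` I. i \<noteq> j \<longrightarrow>
      open_segment (p i) (p j) \<subseteq> R \<or> j = Suc i mod n \<or> i = Suc j mod n"
    using side by blast
  moreover have "interior (convex hull (p ` s ` I)) \<subseteq> R" using I(4) R by blast
  ultimately show ?thesis
    using I(3) unfolding cell_def by simp
qed

lemma cell_inner:
  assumes ch: "chord n p i j" "open_segment (p i) (p j) \<subseteq> R"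
    and "cell (j - i + 1) (inner_sub p i j) R' I" "R' \<subseteq> R"
  shows "cell n p R ((\<lambda>k. i + k) ` I)"
proof (rule cell_sub[OF assms(3) strict_mono_on_imp_inj_on[OF strict_mono_inner] _ assms(4) inner_step[OF ch(1)]])
  show "open_segment (p (i + (j - i))) (p (i + Suc (j - i) mod (j - i + 1))) \<subseteq> R"
    using ch unfolding chord_def by (simp add: open_segment_commute)
qed (use ch in \<open>auto simp: chord_def\<close>)

lemma cell_outer:
  assumes ch: "chord n p i j" "open_segment (p i) (p j) \<subseteq> R"
    and c: "cell (n - (j - i) + 1) (outer_sub p i j) R' I" and "R' \<subseteq> R"
  shows "cell n p R (skip i j ` I)"
proof -
  have ij: "i < j" "j < n" using ch unfolding chord_def by auto
  have *: "Suc i mod (n - (j - i) + 1) = Suc i" "skip i j (Suc i) = j" "skip i j i = i" using ij by auto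
  show ?thesis
  proof (rule cell_sub[OF c strict_mono_on_imp_inj_on[OF strict_mono_outer[OF ij(1)]] _ \<open>R' \<subseteq> R\<close> outer_step[OF ch(1)]])
    show "open_segment (p (skip i j i)) (p (skip i j (Suc i mod (n - (j - i) + 1)))) \<subseteq> R"
      unfolding * by (rule ch(2))
  qed (use ij in auto)
qed

text \<open>In barycentric coordinates, moving from \<open>a\<close> towards \<open>u\<close> does
  not change which of the coordinates of \<open>v\<close> and \<open>w\<close> vanish. So the
  segment stays in the open triangle, or in the open side at \<open>u\<close> that contains
  \<open>a\<close>; that side lies in \<open>R\<close> because \<open>a\<close> is not in
  \<open>P\<close>.\<close>

lemma triangle_sees_vertex:
  fixes u v w :: "real^2"
  assumes nc: "\<not> collinear {u, v, w}" and a: "a \<in> convex hull {u, v, w}" "a \<notin> P"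
    and P: "u \<in> P" "v \<in> P" "w \<in> P" and R: "interior (convex hull {u, v, w}) \<subseteq> R"
    and sides: "open_segment u v \<subseteq> R \<or> open_segment u v \<subseteq> P" "open_segment u w \<subseteq> R \<or> open_segment u w \<subseteq> P"
  shows "open_segment a u \<subseteq> R"
proof
  fix q assume "q \<in> open_segment a u"
  then obtain t where t: "0 < t" "t < 1" "q = (1 - t) *\<^sub>R a + t *\<^sub>R u" by (auto simp: in_segment)
  obtain x y z where xyz: "0 \<le> x" "0 \<le> y" "0 \<le> z" "x + y + z = 1" "a = x *\<^sub>R u + y *\<^sub>R v + z *\<^sub>R w"
    using a(1) unfolding convex_hull_3 by blast
  have q: "q = ((1 - t) * x + t) *\<^sub>R u + ((1 - t) * y) *\<^sub>R v + ((1 - t) * z) *\<^sub>R w"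
    unfolding t(3) xyz(5) by (simp add: algebra_simps)
  have x': "0 < (1 - t) * x + t" using t xyz by (simp add: add_nonneg_pos)
  have sum: "((1 - t) * x + t) + (1 - t) * y + (1 - t) * z = 1"
  proof -
    have "((1 - t) * x + t) + (1 - t) * y + (1 - t) * z = (1 - t) * (x + y + z) + t" by (simp add: algebra_simps)
    then show ?thesis unfolding xyz(4) by simp
  qed
  have ne: "u \<noteq> v" "u \<noteq> w" using nc by (auto simp: insert_commute)
  have open_seg: "\<alpha> *\<^sub>R u + \<beta> *\<^sub>R y \<in> open_segment u y" if "0 < \<alpha>" "0 < \<beta>" "\<alpha> + \<beta> = 1" "u \<noteq> y" for \<alpha> \<beta> y
  proof -
    have "\<alpha> = 1 - \<beta>" using that by simp
    then show ?thesis using that by (auto simp: in_segment intro!: exI[of _ \<beta>])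
  qed
  consider "y > 0" "z > 0" | "y = 0" "z = 0" | "y = 0" "z > 0" | "y > 0" "z = 0" using xyz by linarith
  then show "q \<in> R"
  proof cases
    case 1
    then have "0 < (1 - t) * y" "0 < (1 - t) * z" using t by auto
    then have "q \<in> interior (convex hull {u, v, w})"
      unfolding interior_convex_hull_3_minimal[OF nc, simplified] using q x' sum by blast
    then show ?thesis using R by blast
  next
    case 2
    then have "a = u" using xyz by simp
    then show ?thesis using a P by simp
  next
    case 3
    have "x \<noteq> 0" using 3 xyz a P by auto
    then have "a \<in> open_segment u w" using 3 xyz ne open_seg[of x z w] by simp
    then have "open_segment u w \<subseteq> R" using sides a by blast
    moreover have "q \<in> open_segment u w"
      unfolding q using 3 t x' sum ne open_seg[of "(1 - t) * x + t" "(1 - t) * z" w] by simp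
    ultimately show ?thesis by blast
  next
    case 4
    have "x \<noteq> 0" using 4 xyz a P by auto
    then have "a \<in> open_segment u v" using 4 xyz ne open_seg[of x y v] by simp
    then have "open_segment u v \<subseteq> R" using sides a by blast
    moreover have "q \<in> open_segment u v"
      unfolding q using 4 t x' sum ne open_seg[of "(1 - t) * x + t" "(1 - t) * y" v] by simp
    ultimately show ?thesis by blast
  qed
qed

lemma cell_sees_vertex:
  assumes c: "cell n p R I" and a: "a \<in> convex hull (p ` I)" "a \<notin> polygon n p" and i: "i \<in> I"
  shows "open_segment a (p i) \<subseteq> R"
proof -
  have I: "I \<subseteq> {..<n}" "card I = 3" "\<not> collinear (p ` I)" "interior (convex hull (p ` I)) \<subseteq> R"
    using c unfolding cell_def by auto
  have "card (I - {i}) = 2" using I(2) i by simp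
  then obtain j k where jk: "I - {i} = {j, k}" "j \<noteq> k" by (meson card_2_iff)
  then have Ieq: "I = {i, j, k}" "i \<noteq> j" "i \<noteq> k" using i by auto
  have side: "open_segment (p i) (p h) \<subseteq> R \<or> open_segment (p i) (p h) \<subseteq> polygon n p" if "h \<in> I" "h \<noteq> i" for h
    using c i that I(1) open_segment_subset_edge[of i n h p] unfolding cell_def by (metis lessThan_iff subsetD)
  show ?thesis
    by (rule triangle_sees_vertex[of "p i" "p j" "p k" a "polygon n p"])
      (use I a side Ieq vertex_in_polygon[of _ n p] in auto)
qed

definition cell_pair :: "nat \<Rightarrow> (nat \<Rightarrow> real^2) \<Rightarrow> (real^2) set \<Rightarrow> real^2 \<Rightarrow> real^2 \<Rightarrow> bool" where
  "cell_pair n p R a b \<longleftrightarrow> (\<exists>I J. cell n p R I \<and> cell n p R J \<and>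
     a \<in> convex hull (p ` I) \<and> b \<in> convex hull (p ` J) \<and> noncrossing I J)"

lemma cell_pair_sym: "cell_pair n p R a b \<Longrightarrow> cell_pair n p R b a"
  unfolding cell_pair_def using noncrossing_sym by blast

lemma cell_pair_image:
  assumes "cell_pair m (p \<circ> s) R' a b" "strict_mono_on {..<m} s"
    and "\<And>I. cell m (p \<circ> s) R' I \<Longrightarrow> cell n p R (s ` I)"
  shows "cell_pair n p R a b"
proof -
  obtain I J where IJ: "cell m (p \<circ> s) R' I" "cell m (p \<circ> s) R' J"
     "a \<in> convex hull (p ` s ` I)" "b \<in> convex hull (p ` s ` J)" "noncrossing I J"
    using assms(1) unfolding cell_pair_def by (auto simp: image_comp)
  then have "noncrossing (s ` I) (s ` J)"
    using noncrossing_image[OF assms(2)] unfolding cell_def by blast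
  then show ?thesis using IJ assms(3) unfolding cell_pair_def by blast
qed

text \<open>An alternation in either order would put an element of \<open>J\<close> strictly between
  two elements of \<open>I\<close>.\<close>

lemma noncrossing_separated:
  fixes i j :: nat
  assumes "I \<subseteq> {i..j}" "J \<inter> {i<..<j} = {}"
  shows "noncrossing I J"
proof -
  have I: "i \<le> x" "x \<le> j" if "x \<in> I" for x using that assms by auto
  have J: "\<not> (i < x \<and> x < j)" if "x \<in> J" for x using that assms by auto
  show ?thesis
    unfolding noncrossing_def
  proof
    show "\<not> alternating I J"
    proof
      assume "alternating I J"
      then obtain x y x' where "x \<in> I" "y \<in> J" "x' \<in> I" "x < y" "y < x'"
        unfolding alternating_def by blast
      then show False using I[of x] I[of x'] J[of y] by linarith
    qed
    show "\<not> alternating J I"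
    proof
      assume "alternating J I"
      then obtain x y x' where "x \<in> I" "y \<in> J" "x' \<in> I" "x < y" "y < x'"
        unfolding alternating_def by blast
      then show False using I[of x] I[of x'] J[of y] by linarith
    qed
  qed
qed

lemma inner_image: "(i::nat) < j \<Longrightarrow> I \<subseteq> {..<j - i + 1} \<Longrightarrow> (\<lambda>k. i + k) ` I \<subseteq> {i..j}"
  by auto

lemma outer_image: "(i::nat) < j \<Longrightarrow> skip i j ` J \<inter> {i<..<j} = {}"
  by auto

text \<open>The induction step shared by interior and exterior. \<open>X1\<close> and
  \<open>X2\<close> are the sets of points covered by the two polygons at the chord;
  \<open>R1\<close> and \<open>R2\<close> are the regions of their cells, which may be an inside on
  one side and an outside on the other.\<close>

lemma cell_pair_chord:
  assumes ch: "chord n p i j" "open_segment (p i) (p j) \<subseteq> R" and R: "R1 \<subseteq> R" "R2 \<subseteq> R"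
    and inner: "\<And>x y. x \<in> X1 \<Longrightarrow> y \<in> X1 \<Longrightarrow> cell_pair (j - i + 1) (inner_sub p i j) R1 x y"
    and outer: "\<And>x y. x \<in> X2 \<Longrightarrow> y \<in> X2 \<Longrightarrow> cell_pair (n - (j - i) + 1) (outer_sub p i j) R2 x y"
    and ab: "a \<in> X1 \<union> X2" "b \<in> X1 \<union> X2"
  shows "cell_pair n p R a b"
proof -
  have ij: "i < j" "j < n" using ch unfolding chord_def by auto
  have mixed: "cell_pair n p R x y" if x: "x \<in> X1" and y: "y \<in> X2" for x y
  proof -
    \<comment> \<open>Pairing \<open>x\<close> with itself yields a cell around the single point
      \<open>x\<close>.\<close>
    obtain I where I: "cell (j - i + 1) (inner_sub p i j) R1 I" "x \<in> convex hull (inner_sub p i j ` I)"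
      using inner[OF x x] unfolding cell_pair_def by blast
    obtain J where J: "cell (n - (j - i) + 1) (outer_sub p i j) R2 J" "y \<in> convex hull (outer_sub p i j ` J)"
      using outer[OF y y] unfolding cell_pair_def by blast
    have "I \<subseteq> {..<j - i + 1}" using I unfolding cell_def by simp
    then have "noncrossing ((\<lambda>k. i + k) ` I) (skip i j ` J)"
      by (intro noncrossing_separated[of _ i j] inner_image outer_image ij)
    then show ?thesis
      using cell_inner[OF ch I(1) R(1)] cell_outer[OF ch J(1) R(2)] I(2) J(2)
      unfolding cell_pair_def image_comp[symmetric] by blast
  qed
  have in1: "cell_pair n p R x y" if "x \<in> X1" "y \<in> X1" for x y
    by (rule cell_pair_image[OF inner[OF that] strict_mono_inner]) (rule cell_inner[OF ch _ R(1)])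
  have out1: "cell_pair n p R x y" if "x \<in> X2" "y \<in> X2" for x y
    by (rule cell_pair_image[OF outer[OF that] strict_mono_outer[OF ij(1)]]) (rule cell_outer[OF ch _ R(2)])
  show ?thesis
    using ab mixed in1 out1 cell_pair_sym by blast
qed

lemma triangle_polygon:
  assumes P: "simple_polygon 3 p"
  shows "\<not> collinear {p 0, p 1, p 2}" "polygon 3 p = frontier (convex hull {p 0, p 1, p 2})"
    "inside (polygon 3 p) = interior (convex hull {p 0, p 1, p 2})"
proof -
  have "{..<3::nat} = {0, 1, 2}" by auto
  moreover have E: "polygon_edge 3 p 0 = closed_segment (p 0) (p 1)" "polygon_edge 3 p 1 = closed_segment (p 1) (p 2)"
    "polygon_edge 3 p 2 = closed_segment (p 2) (p 0)"
    unfolding polygon_edge_def by (simp_all add: numeral_2_eq_2)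
  ultimately have P3: "polygon 3 p = closed_segment (p 0) (p 1) \<union> closed_segment (p 1) (p 2) \<union> closed_segment (p 2) (p 0)"
    unfolding polygon_def by (simp only: UN_insert UN_empty Un_empty_right Un_assoc)
  show "polygon 3 p = frontier (convex hull {p 0, p 1, p 2})"
    unfolding P3 by (subst frontier_of_triangle) auto
  show "inside (polygon 3 p) = interior (convex hull {p 0, p 1, p 2})"
    unfolding P3 by (subst inside_of_triangle) auto
  show "\<not> collinear {p 0, p 1, p 2}"
  proof
    assume "collinear {p 0, p 1, p 2}"
    then have "p 0 \<in> polygon_edge 3 p 1 \<or> p 1 \<in> polygon_edge 3 p 2 \<or> p 2 \<in> polygon_edge 3 p 0"
      unfolding collinear_between_cases between_mem_segment E .
    then show False
      using simple_polygon_vertexD[OF P, of 1 0] simple_polygon_vertexD[OF P, of 2 1] simple_polygon_vertexD[OF P, of 0 2]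
      by auto
  qed
qed

text \<open>The boundary is included because the induction must also cover the points of a cutting
  chord, which lie on the boundary of both parts.\<close>

definition region :: "nat \<Rightarrow> (nat \<Rightarrow> real^2) \<Rightarrow> (real^2) set" where
  "region n p = polygon n p \<union> inside (polygon n p)"

lemma noncrossing_card_3: "noncrossing {0, 1, 2} {0, 1, 2}"
  unfolding noncrossing_def alternating_def by auto

theorem inside_triangulation:
  assumes "simple_polygon n p" "a \<in> region n p" "b \<in> region n p"
  shows "cell_pair n p (inside (polygon n p)) a b"
  using assms
proof (induction n arbitrary: p a b rule: less_induct)
  case (less n)
  note P = less.prems(1)
  have n3: "n \<ge> 3" using P unfolding simple_polygon_def by blast
  show ?case
  proof (cases "n = 3")
    case True
    then have P3: "simple_polygon 3 p" using P by simp
    let ?I = "{0, 1, 2::nat}"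
    note T = triangle_polygon[OF P3]
    have "region 3 p = convex hull {p 0, p 1, p 2}"
      unfolding region_def T(3) unfolding T(2) frontier_def
      using interior_subset[of "convex hull {p 0, p 1, p 2}"] by (auto simp: closure_convex_hull finite_imp_compact)
    then have ab: "a \<in> convex hull (p ` ?I)" "b \<in> convex hull (p ` ?I)" using less.prems True by auto
    have "cell 3 p (inside (polygon 3 p)) ?I"
      unfolding cell_def T(3) using T(1) by auto
    then show ?thesis using ab True noncrossing_card_3 unfolding cell_pair_def by blast
  next
    case False
    then have "n \<ge> 4" using n3 by simp
    then obtain i j where ch: "chord n p i j" "open_segment (p i) (p j) \<subseteq> inside (polygon n p)"
      using exists_interior_chord[OF P] by blast
    have ij: "i < j" "j < n" using ch unfolding chord_def by auto
    note inner = inner_sub_polygon[OF P ch(1)] and outer = outer_sub_polygon[OF P ch(1)]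
    note adj = chord_not_adjacent[OF P ch(1)]
    have "p i \<noteq> p j" using simple_polygon_inj[OF P _ ij(2), of i] ij by auto
    then have "open_segment (p i) (p j) \<noteq> {}" by simp
    then have "open_segment (p i) (p j) \<inter> inside (inner_chain n p i j \<union> outer_chain n p i j) \<noteq> {}"
      using ch(2) unfolding polygon_eq_chains[OF ij] by blast
    from chord_split[OF P ch(1) this]
    have split: "inside (polygon n p) = inside (polygon (j - i + 1) (inner_sub p i j)) \<union>
        inside (polygon (n - (j - i) + 1) (outer_sub p i j)) \<union> open_segment (p i) (p j)"
      unfolding inner(2) outer(2) polygon_eq_chains[OF ij] by simp
    have "region n p \<subseteq> region (j - i + 1) (inner_sub p i j) \<union> region (n - (j - i) + 1) (outer_sub p i j)"
      unfolding region_def split unfolding inner(2) outer(2) unfolding polygon_eq_chains[OF ij]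
      using segment_open_subset_closed[of "p i" "p j"] by blast
    then have ab: "a \<in> region (j - i + 1) (inner_sub p i j) \<union> region (n - (j - i) + 1) (outer_sub p i j)"
      "b \<in> region (j - i + 1) (inner_sub p i j) \<union> region (n - (j - i) + 1) (outer_sub p i j)"
      using less.prems by blast+
    have m: "j - i + 1 < n" "n - (j - i) + 1 < n" using adj ij by auto
    have sub: "inside (polygon (j - i + 1) (inner_sub p i j)) \<subseteq> inside (polygon n p)"
      "inside (polygon (n - (j - i) + 1) (outer_sub p i j)) \<subseteq> inside (polygon n p)"
      unfolding split by blast+
    show ?thesis
      by (rule cell_pair_chord[OF ch sub less.IH[OF m(1) inner(1)] less.IH[OF m(2) outer(1)] ab])
  qed
qed

section \<open>Edges of the convex hull\<close>

text \<open>Rotation by a right angle. On a line where the inner product with \<open>h\<close> is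
  constant, the inner product with \<open>perp h\<close> is a coordinate along the line.\<close>

definition perp :: "real^2 \<Rightarrow> real^2" where
  "perp h = vector [- h $ 2, h $ 1]"

lemma perp_inner: "perp h \<bullet> x = h $ 1 * x $ 2 - h $ 2 * x $ 1"
  by (simp add: perp_def inner_vec_def sum_2)

lemma inner_real2: "h \<bullet> x = h $ 1 * x $ 1 + h $ 2 * x $ (2::2)" for h x :: "real^2"
  by (simp add: inner_vec_def sum_2)

lemma perp_eq_0_iff: "perp h = 0 \<longleftrightarrow> h = 0"
  by (auto simp: perp_def vec_eq_iff forall_2)

lemma perp_inner_self: "perp h \<bullet> h = 0" "h \<bullet> perp h = 0"
  by (simp_all add: perp_inner inner_commute[of h "perp h"])

lemma perp_eqI:
  assumes "h \<noteq> 0" "h \<bullet> x = h \<bullet> y" "perp h \<bullet> x = perp h \<bullet> y"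
  shows "x = y"
proof -
  define d where "d = x - y"
  have "h \<bullet> d = 0" "perp h \<bullet> d = 0" using assms unfolding d_def by (simp_all add: inner_diff_right)
  then have e: "h $ 1 * d $ 1 + h $ 2 * d $ 2 = 0" "h $ 1 * d $ 2 - h $ 2 * d $ 1 = 0"
    by (simp_all add: perp_inner inner_real2[of h])
  have "(h \<bullet> h) * d $ 1 = 0" "(h \<bullet> h) * d $ 2 = 0"
    unfolding inner_real2 using e by algebra+
  then have "d = 0" using \<open>h \<noteq> 0\<close> by (auto simp: vec_eq_iff forall_2)
  then show ?thesis unfolding d_def by simp
qed

lemma line_segment_memI:
  assumes h: "h \<noteq> 0" "h \<bullet> x = m" "h \<bullet> y = m" "h \<bullet> z = m"
    and e: "perp h \<bullet> x \<le> perp h \<bullet> z" "perp h \<bullet> z \<le> perp h \<bullet> y"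
  shows "z \<in> closed_segment x y"
    "perp h \<bullet> x < perp h \<bullet> z \<Longrightarrow> perp h \<bullet> z < perp h \<bullet> y \<Longrightarrow> z \<in> open_segment x y"
proof -
  let ?e = "\<lambda>x. perp h \<bullet> x"
  show mem: "z \<in> closed_segment x y"
  proof -
    have "?e z \<in> closed_segment (?e x) (?e y)" using e by (simp add: closed_segment_eq_real_ivl)
    then obtain t where t: "0 \<le> t" "t \<le> 1" "?e z = (1 - t) * ?e x + t * ?e y"
      unfolding in_segment by auto
    have "z = (1 - t) *\<^sub>R x + t *\<^sub>R y"
      by (rule perp_eqI[OF h(1)]) (use t h in \<open>simp_all add: inner_add_right algebra_simps\<close>)
    then show ?thesis unfolding in_segment using t by blast
  qed
  show "z \<in> open_segment x y" if "?e x < ?e z" "?e z < ?e y"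
    using mem that unfolding open_segment_def by auto
qed

text \<open>An open half-space together with an open half of its boundary; it allows points within a
  supporting line to be compared by a convexity argument.\<close>

lemma convex_lexicographic_halfplane:
  fixes h e :: "'a::real_inner"
  shows "convex {x. h \<bullet> x < m \<or> h \<bullet> x = m \<and> c < e \<bullet> x}"
proof (rule convexI)
  fix x y and u v :: real
  assume x: "x \<in> {x. h \<bullet> x < m \<or> h \<bullet> x = m \<and> c < e \<bullet> x}" and y: "y \<in> {x. h \<bullet> x < m \<or> h \<bullet> x = m \<and> c < e \<bullet> x}"
    and uv: "0 \<le> u" "0 \<le> v" "u + v = 1"
  show "u *\<^sub>R x + v *\<^sub>R y \<in> {x. h \<bullet> x < m \<or> h \<bullet> x = m \<and> c < e \<bullet> x}"
  proof (cases "u = 0 \<or> v = 0")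
    case True then show ?thesis using x y uv by auto
  next
    case False
    then have pos: "0 < u" "0 < v" using uv by auto
    have hz: "h \<bullet> (u *\<^sub>R x + v *\<^sub>R y) = u * (h \<bullet> x) + v * (h \<bullet> y)" "e \<bullet> (u *\<^sub>R x + v *\<^sub>R y) = u * (e \<bullet> x) + v * (e \<bullet> y)"
      by (simp_all add: inner_add_right)
    have m: "m = u * m + v * m" "c = u * c + v * c" using uv by (simp_all add: distrib_right[symmetric])
    consider "h \<bullet> x < m" "h \<bullet> y \<le> m" | "h \<bullet> x = m" "h \<bullet> y < m" | "h \<bullet> x = m" "c < e \<bullet> x" "h \<bullet> y = m" "c < e \<bullet> y"
      using x y by fastforce
    then show ?thesis
    proof cases
      case 1
      have "u * (h \<bullet> x) + v * (h \<bullet> y) < u * m + v * m"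
        using 1 pos by (intro add_less_le_mono) auto
      then show ?thesis using hz m by simp
    next
      case 2
      have "u * (h \<bullet> x) + v * (h \<bullet> y) < u * m + v * m"
        using 2 pos by (intro add_le_less_mono) auto
      then show ?thesis using hz m by simp
    next
      case 3
      have "u * c + v * c < u * (e \<bullet> x) + v * (e \<bullet> y)"
        using 3 pos by (intro add_strict_mono) auto
      then show ?thesis using hz m 3 by simp
    qed
  qed
qed

text \<open>Otherwise all of \<open>V\<close> would lie in the lexicographic half-space beyond
  \<open>y\<close>, which is convex and misses \<open>y\<close>.\<close>

lemma hull_face_vertex:
  fixes V :: "'a::real_inner set"
  assumes V: "\<And>v. v \<in> V \<Longrightarrow> h \<bullet> v \<le> m" and y: "y \<in> convex hull V" "h \<bullet> y = m" "y \<notin> V"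
    and eq: "\<And>v. v \<in> V \<Longrightarrow> h \<bullet> v = m \<Longrightarrow> e \<bullet> v = e \<bullet> y \<Longrightarrow> v = y"
  shows "\<exists>v\<in>V. h \<bullet> v = m \<and> e \<bullet> v < e \<bullet> y"
proof (rule ccontr)
  assume no: "\<not> ?thesis"
  have "V \<subseteq> {x. h \<bullet> x < m \<or> h \<bullet> x = m \<and> e \<bullet> y < e \<bullet> x}"
  proof
    fix v assume v: "v \<in> V"
    have "e \<bullet> v \<noteq> e \<bullet> y" if "h \<bullet> v = m" using eq[OF v that] y v by blast
    then show "v \<in> {x. h \<bullet> x < m \<or> h \<bullet> x = m \<and> e \<bullet> y < e \<bullet> x}"
      using V[OF v] no v by force
  qed
  then have "convex hull V \<subseteq> {x. h \<bullet> x < m \<or> h \<bullet> x = m \<and> e \<bullet> y < e \<bullet> x}"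
    by (rule hull_minimal) (rule convex_lexicographic_halfplane)
  then show False using y by auto
qed

text \<open>\<open>h\<close> is the outer normal of a supporting line. Vertices inside a side of the
  hull are allowed, so for a simple polygon \<open>i\<close> and \<open>j\<close> are neighbours on
  that line rather than extreme points: they span an edge of the polygon or the lid of a
  pocket.\<close>

definition hull_edge :: "nat \<Rightarrow> (nat \<Rightarrow> real^2) \<Rightarrow> real^2 \<Rightarrow> nat \<Rightarrow> nat \<Rightarrow> bool" where
  "hull_edge n p h i j \<longleftrightarrow> i < n \<and> j < n \<and> i \<noteq> j \<and> h \<bullet> p i = h \<bullet> p j \<and> (\<forall>k<n. h \<bullet> p k \<le> h \<bullet> p i) \<and>
     (j = Suc i mod n \<or> i = Suc j mod n \<or> open_segment (p i) (p j) \<inter> polygon n p = {})"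

lemma hull_edge_sym: "hull_edge n p h i j \<Longrightarrow> hull_edge n p h j i"
  unfolding hull_edge_def by (auto simp: open_segment_commute)

text \<open>\<open>i\<close> and \<open>j\<close> are the vertices on the supporting line that are
  closest to \<open>y\<close> on either side; both sides are occupied by
  \<open>hull_face_vertex\<close>, applied to \<open>perp h\<close> and to its negative.\<close>

lemma exists_hull_edge:
  assumes P: "simple_polygon n p" and h: "h \<noteq> 0" "\<And>k. k < n \<Longrightarrow> h \<bullet> p k \<le> m"
    and y: "y \<in> convex hull (p ` {..<n})" "h \<bullet> y = m" "y \<notin> p ` {..<n}"
  obtains i j where "hull_edge n p h i j" "h \<bullet> p i = m" "y \<in> open_segment (p i) (p j)"
proof -
  let ?e = "\<lambda>x. perp h \<bullet> x"
  have n: "n \<ge> 3" using P unfolding simple_polygon_def by blast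
  define L where "L = {k. k < n \<and> h \<bullet> p k = m \<and> ?e (p k) < ?e y}"
  define U where "U = {k. k < n \<and> h \<bullet> p k = m \<and> ?e y < ?e (p k)}"
  have V: "h \<bullet> v \<le> m" if "v \<in> p ` {..<n}" for v using that h by auto
  have eq: "v = y" if "h \<bullet> v = m" "?e v = ?e y" for v
    using perp_eqI[OF h(1), of v y] that y by simp
  have ne: "L \<noteq> {}"
    using hull_face_vertex[OF V y, of "perp h"] eq unfolding L_def by auto
  have "\<exists>v\<in>p ` {..<n}. h \<bullet> v = m \<and> (- perp h) \<bullet> v < (- perp h) \<bullet> y"
    by (rule hull_face_vertex[OF V y]) (use eq in auto)
  then have ne': "U \<noteq> {}" unfolding U_def by auto
  have fin: "finite L" "finite U" unfolding L_def U_def by auto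
  define i where "i = arg_min_on (\<lambda>k. - ?e (p k)) L"
  define j where "j = arg_min_on (\<lambda>k. ?e (p k)) U"
  have i: "i \<in> L" and j: "j \<in> U"
    using arg_min_if_finite(1) fin ne ne' unfolding i_def j_def by blast+
  have imax: "?e (p k) \<le> ?e (p i)" if "k \<in> L" for k
    using arg_min_least[OF fin(1) ne that, of "\<lambda>k. - ?e (p k)"] unfolding i_def by simp
  have jmin: "?e (p j) \<le> ?e (p k)" if "k \<in> U" for k
    using arg_min_least[OF fin(2) ne' that, of "\<lambda>k. ?e (p k)"] unfolding j_def by simp
  have i': "i < n" "h \<bullet> p i = m" "?e (p i) < ?e y" and j': "j < n" "h \<bullet> p j = m" "?e y < ?e (p j)"
    using i j unfolding L_def U_def by auto
  have gap: "?e (p k) \<le> ?e (p i) \<or> ?e (p j) \<le> ?e (p k)" if k: "k < n" "h \<bullet> p k = m" for k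
  proof -
    have "?e (p k) \<noteq> ?e y" using eq[OF k(2)] y k by auto
    then have "k \<in> L \<or> k \<in> U" unfolding L_def U_def using k by auto
    then show ?thesis using imax jmin by blast
  qed
  \<comment> \<open>An edge through a point \<open>q\<close> of the open segment stays on the
    supporting line, since \<open>q\<close> is interior to the edge and neither end lies above the
    line. No vertex lies strictly between \<open>p i\<close> and \<open>p j\<close>, so the edge
    covers both, and they are its ends.\<close>
  have "j = Suc i mod n \<or> i = Suc j mod n" if meets: "open_segment (p i) (p j) \<inter> polygon n p \<noteq> {}"
  proof -
    obtain q where q: "q \<in> open_segment (p i) (p j)" "q \<in> polygon n p" using meets by blast
    obtain s where s: "0 < s" "s < 1" "q = (1 - s) *\<^sub>R p i + s *\<^sub>R p j"
      using q(1) unfolding in_segment by blast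
    have hq: "h \<bullet> q = m" unfolding s using i' j' by (simp add: inner_add_right algebra_simps)
    have eq1: "?e q = ?e (p i) + s * (?e (p j) - ?e (p i))" "?e q = ?e (p j) - (1 - s) * (?e (p j) - ?e (p i))"
      unfolding s by (simp_all add: inner_add_right algebra_simps)
    have "0 < s * (?e (p j) - ?e (p i))" "0 < (1 - s) * (?e (p j) - ?e (p i))"
      using s i' j' by simp_all
    then have eq2: "?e (p i) < ?e q" "?e q < ?e (p j)" using eq1 by linarith+
    obtain k where k: "k < n" "q \<in> polygon_edge n p k" using q(2) unfolding polygon_def by blast
    let ?k = "Suc k mod n"
    have k': "?k < n" using n by simp
    obtain t where t: "0 \<le> t" "t \<le> 1" "q = (1 - t) *\<^sub>R p k + t *\<^sub>R p ?k"
      using k(2) unfolding polygon_edge_def in_segment by blast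
    have not_vertex: "q \<noteq> p l" if "l < n" for l
      using gap[OF that] hq eq2 by auto
    have t01: "0 < t" "t < 1" using not_vertex[OF k(1)] not_vertex[OF k'] t by (auto simp: less_le)
    have "(1 - t) * (m - h \<bullet> p k) + t * (m - h \<bullet> p ?k) = 0"
      using hq unfolding t by (simp add: inner_add_right algebra_simps)
    moreover have "(1 - t) * (m - h \<bullet> p k) \<ge> 0" "t * (m - h \<bullet> p ?k) \<ge> 0"
      using t01 h(2)[OF k(1)] h(2)[OF k'] by simp_all
    ultimately have "(1 - t) * (m - h \<bullet> p k) = 0" "t * (m - h \<bullet> p ?k) = 0" by linarith+
    then have hk: "h \<bullet> p k = m" "h \<bullet> p ?k = m" using t01 by auto
    have eqt: "?e q = (1 - t) * ?e (p k) + t * ?e (p ?k)"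
      unfolding t(3) by (simp add: inner_add_right)
    have "\<not> (?e (p j) \<le> ?e (p k) \<and> ?e (p j) \<le> ?e (p ?k))"
    proof
      assume *: "?e (p j) \<le> ?e (p k) \<and> ?e (p j) \<le> ?e (p ?k)"
      then show False
        using convex_comb_greater[of "?e q" "?e (p k)" "?e (p ?k)" t] t eqt eq2 by linarith
    qed
    moreover have "\<not> (?e (p k) \<le> ?e (p i) \<and> ?e (p ?k) \<le> ?e (p i))"
    proof
      assume *: "?e (p k) \<le> ?e (p i) \<and> ?e (p ?k) \<le> ?e (p i)"
      have "- ?e q < (1 - t) * - ?e (p k) + t * - ?e (p ?k)"
        by (rule convex_comb_greater) (use * t eq2 in auto)
      then show False using eqt by simp
    qed
    ultimately have cases: "?e (p k) \<le> ?e (p i) \<and> ?e (p j) \<le> ?e (p ?k) \<or> ?e (p ?k) \<le> ?e (p i) \<and> ?e (p j) \<le> ?e (p k)"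
      using gap[OF k(1) hk(1)] gap[OF k' hk(2)] by linarith
    have less: "?e (p i) < ?e (p j)" using i' j' by linarith
    have "p i \<in> polygon_edge n p k" "p j \<in> polygon_edge n p k"
      using cases
    proof (atomize(full), elim disjE)
      assume "?e (p k) \<le> ?e (p i) \<and> ?e (p j) \<le> ?e (p ?k)"
      then show "p i \<in> polygon_edge n p k \<and> p j \<in> polygon_edge n p k"
        unfolding polygon_edge_def using line_segment_memI(1)[OF h(1) hk] i' j' less by simp
    next
      assume "?e (p ?k) \<le> ?e (p i) \<and> ?e (p j) \<le> ?e (p k)"
      then show "p i \<in> polygon_edge n p k \<and> p j \<in> polygon_edge n p k"
        unfolding polygon_edge_def closed_segment_commute[of "p k"]
        using line_segment_memI(1)[OF h(1) hk(2,1)] i' j' less by simp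
    qed
    then have "i = k \<or> i = ?k" "j = k \<or> j = ?k" using simple_polygon_vertexD[OF P k(1)] i' j' by blast+
    moreover have "i \<noteq> j" using less by blast
    ultimately show ?thesis by blast
  qed
  then have "hull_edge n p h i j"
    unfolding hull_edge_def using i' j' h(2) by auto
  moreover have "y \<in> open_segment (p i) (p j)"
    using line_segment_memI(2)[OF h(1) i'(2) j'(2) y(2)] i' j' by simp
  ultimately show ?thesis using that i' by blast
qed

section \<open>The convex hull of the polygon and its supporting lines\<close>

definition polygon_hull :: "nat \<Rightarrow> (nat \<Rightarrow> real^2) \<Rightarrow> (real^2) set" where
  "polygon_hull n p = convex hull (p ` {..<n})"

lemma polygon_subset_hull: "polygon n p \<subseteq> polygon_hull n p"
proof -
  have "polygon_edge n p k \<subseteq> polygon_hull n p" if "k < n" for k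
  proof -
    have "Suc k mod n < n" using that by simp
    then show ?thesis
      unfolding polygon_edge_def polygon_hull_def using that
      by (intro closed_segment_subset convex_convex_hull hull_inc) auto
  qed
  then show ?thesis unfolding polygon_def by blast
qed

lemma hull_halfplane:
  assumes "\<And>k. k < n \<Longrightarrow> h \<bullet> p k \<le> m"
  shows "polygon_hull n p \<subseteq> {x. h \<bullet> x \<le> m}"
  unfolding polygon_hull_def by (rule hull_minimal) (use assms in \<open>auto simp: convex_halfspace_le\<close>)

lemma compact_polygon_hull: "compact (polygon_hull n p)"
  unfolding polygon_hull_def by (intro finite_imp_compact_convex_hull) simp

lemma convex_polygon_hull: "convex (polygon_hull n p)"
  unfolding polygon_hull_def by simp

lemma outside_hull: "- polygon_hull n p \<subseteq> outside (polygon n p)"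
  by (rule outside_subset_convex[OF convex_polygon_hull polygon_subset_hull])

lemma inside_subset_hull: "inside (polygon n p) \<subseteq> polygon_hull n p"
  using outside_hull[of n p] by (auto simp: inside_outside)

lemma interior_hull_nonempty:
  assumes "simple_polygon n p"
  shows "interior (polygon_hull n p) \<noteq> {}"
  using interior_maximal[OF inside_subset_hull open_inside[OF closed_polygon]] Jordan_polygon(1)[OF assms] by blast

lemma hull_support:
  assumes P: "simple_polygon n p" and y: "y \<in> frontier (polygon_hull n p)"
  obtains h where "h \<noteq> 0" "\<And>k. k < n \<Longrightarrow> h \<bullet> p k \<le> h \<bullet> y"
    "\<And>x. x \<in> interior (polygon_hull n p) \<Longrightarrow> h \<bullet> x < h \<bullet> y"
proof -
  let ?H = "polygon_hull n p"
  have ri: "rel_interior ?H = interior ?H"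
    by (rule rel_interior_nonempty_interior[OF interior_hull_nonempty[OF P]])
  have y': "y \<in> closure ?H" "y \<notin> rel_interior ?H" using y unfolding ri frontier_def by auto
  obtain g where g: "g \<noteq> 0" "\<And>x. x \<in> closure ?H \<Longrightarrow> g \<bullet> y \<le> g \<bullet> x"
    "\<And>x. x \<in> interior ?H \<Longrightarrow> g \<bullet> y < g \<bullet> x"
    using supporting_hyperplane_relative_frontier[OF convex_polygon_hull y', unfolded ri] by blast
  have "p k \<in> closure ?H" if "k < n" for k
    using that closure_subset[of ?H] unfolding polygon_hull_def by (meson hull_inc imageI lessThan_iff subsetD)
  then show ?thesis
    using that[of "- g"] g by simp
qed

lemma frontier_hull_subset: "frontier (polygon_hull n p) \<subseteq> polygon_hull n p"
  by (simp add: compact_imp_closed compact_polygon_hull frontier_subset_eq)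

text \<open>The outside is connected and has points in the hull and points beyond it, so it meets
  the frontier of the hull. A hull edge through such a point is no edge of the polygon.\<close>

lemma exists_lid:
  assumes P: "simple_polygon n p" and a: "a \<in> outside (polygon n p)" "a \<in> polygon_hull n p"
  obtains i j h where "chord n p i j" "hull_edge n p h i j" "h \<noteq> 0"
proof -
  let ?H = "polygon_hull n p"
  have "connected (outside (polygon n p))" by (rule connected_outside[OF bounded_polygon]) simp
  moreover have "outside (polygon n p) - ?H \<noteq> {}"
  proof -
    have "?H \<noteq> UNIV"
      using compact_imp_bounded[OF compact_polygon_hull] not_bounded_UNIV by metis
    then show ?thesis using outside_hull[of n p] by blast
  qed
  ultimately obtain y where y: "y \<in> outside (polygon n p)" "y \<in> frontier ?H"
    using connected_Int_frontier[of "outside (polygon n p)" ?H] a by blast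
  obtain h where h: "h \<noteq> 0" "\<And>k. k < n \<Longrightarrow> h \<bullet> p k \<le> h \<bullet> y"
    using hull_support[OF P y(2)] by metis
  have yP: "y \<notin> polygon n p" using y(1) by (auto simp: outside_def)
  then have "y \<notin> p ` {..<n}" using vertex_in_polygon by auto
  moreover have "y \<in> convex hull (p ` {..<n})"
    using y(2) frontier_hull_subset unfolding polygon_hull_def by blast
  ultimately obtain i j where ij: "hull_edge n p h i j" "y \<in> open_segment (p i) (p j)"
    using exists_hull_edge[OF P h _ refl] by metis
  have ij': "i < n" "j < n" "i \<noteq> j" using ij unfolding hull_edge_def by auto
  have "\<not> (j = Suc i mod n \<or> i = Suc j mod n)"
    using open_segment_subset_edge[OF ij'(1,2), of p] ij(2) yP by blast
  then have "open_segment (p i) (p j) \<inter> polygon n p = {}" using ij(1) unfolding hull_edge_def by blast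
  then show ?thesis
    using ij' h(1) ij(1) hull_edge_sym[OF ij(1)] that[of i j h] that[of j i h] unfolding chord_def
    by (metis linorder_neqE_nat open_segment_commute)
qed

text \<open>A segment from \<open>a\<close> into the interior of the hull crosses the frontier at a
  point \<open>y\<close>, and the supporting line at \<open>y\<close> has \<open>a\<close> beyond
  it. To apply \<open>exists_hull_edge\<close>, \<open>y\<close> must not be a vertex; a generic end
  point of the segment ensures this.\<close>

lemma exists_visible_hull_edge:
  assumes P: "simple_polygon n p" and a: "a \<notin> polygon_hull n p"
  obtains i j h where "hull_edge n p h i j" "h \<noteq> 0" "h \<bullet> p i < h \<bullet> a"
proof -
  let ?H = "polygon_hull n p"
  \<comment> \<open>The line through \<open>a\<close> and \<open>p k\<close>; finitely many such
    null sets cannot cover the interior of the hull.\<close>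
  define S where "S k = {x. perp (p k - a) \<bullet> x = perp (p k - a) \<bullet> a}" for k
  have ne_a: "p k \<noteq> a" if "k < n" for k
    using a that unfolding polygon_hull_def by (metis hull_inc imageI lessThan_iff)
  have "negligible (\<Union>(S ` {..<n}))"
  proof (rule negligible_Union)
    fix T assume "T \<in> S ` {..<n}"
    then obtain k where k: "k < n" "T = S k" by auto
    then have "perp (p k - a) \<noteq> 0" using ne_a[of k] by (simp add: perp_eq_0_iff)
    then show "negligible T"
      unfolding k(2) S_def by (intro negligible_hyperplane disjI1)
  qed simp
  moreover have "\<not> negligible (interior ?H)"
    by (rule open_not_negligible) (use interior_hull_nonempty[OF P] in auto)
  ultimately obtain c where c: "c \<in> interior ?H" "c \<notin> \<Union>(S ` {..<n})"
    using negligible_subset by blast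
  have cH: "c \<in> ?H" using c interior_subset by blast
  obtain y where y: "y \<in> closed_segment a c" "y \<in> frontier ?H"
    using connected_Int_frontier[OF connected_segment(1)[of a c], of ?H] a cH by auto
  obtain h where h: "h \<noteq> 0" "\<And>k. k < n \<Longrightarrow> h \<bullet> p k \<le> h \<bullet> y" "h \<bullet> c < h \<bullet> y"
    using hull_support[OF P y(2)] c(1) by metis
  obtain t where t: "0 \<le> t" "t \<le> 1" "y = (1 - t) *\<^sub>R a + t *\<^sub>R c"
    using y(1) unfolding in_segment by blast
  have "t \<noteq> 1" using t h by auto
  have "y \<in> ?H" using y(2) frontier_hull_subset by blast
  then have "y \<noteq> a" using a by blast
  then have "t \<noteq> 0" using t by auto
  have ya: "y - a = t *\<^sub>R (c - a)" unfolding t by (simp add: algebra_simps)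
  have "y \<notin> p ` {..<n}"
  proof
    assume "y \<in> p ` {..<n}"
    then obtain k where k: "k < n" "p k - a = t *\<^sub>R (c - a)" using ya by auto
    have "perp (p k - a) \<bullet> (c - a) = 0"
      using perp_inner_self(1)[of "p k - a"] \<open>t \<noteq> 0\<close> unfolding k(2) by simp
    then have "c \<in> S k" unfolding S_def by (simp add: inner_diff_right)
    then show False using c(2) k(1) by blast
  qed
  moreover have "y \<in> convex hull (p ` {..<n})" using \<open>y \<in> ?H\<close> unfolding polygon_hull_def .
  ultimately obtain i j where ij: "hull_edge n p h i j" "h \<bullet> p i = h \<bullet> y"
    using exists_hull_edge[OF P h(1,2) _ refl] by metis
  \<comment> \<open>\<open>y\<close> lies between \<open>a\<close> and \<open>c\<close>, and
    \<open>c\<close> is strictly below the supporting line.\<close>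
  have "h \<bullet> y < h \<bullet> a"
  proof -
    have "(1 - t) * (h \<bullet> a - h \<bullet> y) = t * (h \<bullet> y - h \<bullet> c)"
    proof -
      have "h \<bullet> y = (1 - t) * (h \<bullet> a) + t * (h \<bullet> c)" unfolding t by (simp add: inner_add_right)
      then show ?thesis by (simp add: algebra_simps)
    qed
    moreover have "t * (h \<bullet> y - h \<bullet> c) > 0" using h \<open>t \<noteq> 0\<close> t by simp
    ultimately have "(1 - t) * (h \<bullet> a - h \<bullet> y) > 0" by simp
    then show ?thesis using t by (simp add: zero_less_mult_iff)
  qed
  then show ?thesis using that ij h(1) by metis
qed

section \<open>Pockets and triangulation of the exterior\<close>

lemma halfplane_outside:
  fixes S :: "(real^2) set"
  assumes "S \<subseteq> {x. h \<bullet> x \<le> m}"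
  shows "{x. m < h \<bullet> x} \<subseteq> outside S"
proof -
  have "- {x. h \<bullet> x \<le> m} \<subseteq> outside S"
    by (rule outside_subset_convex[OF convex_halfspace_le assms])
  then show ?thesis by (auto simp: subset_iff not_le)
qed

text \<open>A small disc around \<open>x\<close> avoids \<open>S\<close> and reaches beyond the
  supporting line.\<close>

lemma supporting_segment_outside:
  fixes S :: "(real^2) set"
  assumes h: "h \<noteq> 0" and S: "closed S" "S \<subseteq> {x. h \<bullet> x \<le> m}" and x: "h \<bullet> x = m" "x \<notin> S"
  shows "x \<in> outside S"
proof -
  obtain e where e: "e > 0" "ball x e \<subseteq> - S"
    using S(1) x(2) by (metis ComplI open_Compl open_contains_ball)
  let ?y = "x + (e / (2 * norm h)) *\<^sub>R h"
  have "?y \<in> ball x e" using e h by (simp add: dist_norm)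
  moreover have "?y \<in> outside S"
  proof -
    have "0 < (e / (2 * norm h)) * (h \<bullet> h)" using e h by simp
    then have "m < h \<bullet> ?y" using x by (simp add: inner_add_right)
    then show ?thesis using halfplane_outside[OF S(2)] by blast
  qed
  ultimately have "ball x e \<inter> outside S \<noteq> {}" by blast
  moreover have "ball x e \<inter> S = {}" using e(2) by blast
  ultimately have "ball x e \<subseteq> outside S"
    using connected_subset_outside[OF convex_connected[OF convex_ball]] by blast
  then show ?thesis using e(1) by auto
qed

text \<open>Inside points come arbitrarily close to \<open>x\<close>. None of them lies above the
  line, and as the inside is open, one of them can be pushed strictly below it. The half disc is
  connected and avoids the polygon, so all of it is inside.\<close>

lemma lid_below_inside:
  assumes Q: "simple_polygon m q" and h: "h \<noteq> 0" "\<And>k. k < m \<Longrightarrow> h \<bullet> q k \<le> c"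
    and x: "x \<in> polygon m q" and e: "e > 0"
    and disj: "ball x e \<inter> {y. h \<bullet> y < c} \<inter> polygon m q = {}"
  shows "ball x e \<inter> {y. h \<bullet> y < c} \<subseteq> inside (polygon m q)"
proof (rule connected_subset_inside)
  show "connected (ball x e \<inter> {y. h \<bullet> y < c})"
    by (intro convex_connected convex_Int convex_ball convex_halfspace_lt)
  have "x \<in> closure (inside (polygon m q))"
    using Jordan_polygon(3)[OF Q] x unfolding frontier_def by blast
  then obtain z where z: "z \<in> inside (polygon m q)" "dist z x < e"
    using e closure_approachable by blast
  have "open (inside (polygon m q) \<inter> ball x e)" by (intro open_Int open_inside closed_polygon open_ball)
  then obtain d where d: "d > 0" "ball z d \<subseteq> inside (polygon m q) \<inter> ball x e"
    using z by (metis IntI dist_commute mem_ball open_contains_ball)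
  let ?y = "z - (d / (2 * norm h)) *\<^sub>R h"
  have "?y \<in> ball z d" using d h by (simp add: dist_norm)
  then have y: "?y \<in> inside (polygon m q)" "?y \<in> ball x e" using d(2) by blast+
  have "h \<bullet> z \<le> c"
    using subsetD[OF inside_subset_hull z(1)] hull_halfplane[of m h q c] h(2) by auto
  moreover have "0 < (d / (2 * norm h)) * (h \<bullet> h)" using d h by simp
  ultimately have "h \<bullet> ?y < c" by (simp add: inner_diff_right)
  then show "ball x e \<inter> {y. h \<bullet> y < c} \<inter> inside (polygon m q) \<noteq> {}" using y by blast
qed (rule disj)

text \<open>A lid is a chord that is also a hull edge. From here on \<open>A\<close> and
  \<open>B\<close> are the chains between its ends, no longer coordinates, and \<open>D\<close> is
  the closed lid.\<close>

locale polygon_lid =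
  fixes n p h i j
  assumes P: "simple_polygon n p" and ch: "chord n p i j" and he: "hull_edge n p h i j" and h0: "h \<noteq> 0"
begin

abbreviation "A \<equiv> inner_chain n p i j"
abbreviation "B \<equiv> outer_chain n p i j"
abbreviation "D \<equiv> closed_segment (p i) (p j)"

lemma ij: "i < j" "j < n" using ch unfolding chord_def by auto

lemma P_eq: "polygon n p = A \<union> B" by (rule polygon_eq_chains[OF ij])

lemmas inner = inner_sub_polygon[OF P ch]
lemmas outer = outer_sub_polygon[OF P ch]

lemma h_le: "k < n \<Longrightarrow> h \<bullet> p k \<le> h \<bullet> p i" and h_eq: "h \<bullet> p j = h \<bullet> p i"
  using he unfolding hull_edge_def by auto

lemma h_D:
  assumes "x \<in> D"
  shows "h \<bullet> x = h \<bullet> p i"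
proof -
  obtain t where t: "x = (1 - t) *\<^sub>R p i + t *\<^sub>R p j" using assms unfolding in_segment by blast
  show ?thesis unfolding t by (simp add: inner_add_right h_eq left_diff_distrib)
qed

lemma lid_outside: "open_segment (p i) (p j) \<subseteq> outside (polygon n p)"
proof
  fix x assume x: "x \<in> open_segment (p i) (p j)"
  have "polygon n p \<subseteq> {x. h \<bullet> x \<le> h \<bullet> p i}"
    using polygon_subset_hull hull_halfplane h_le by blast
  moreover have "h \<bullet> x = h \<bullet> p i" using h_D x segment_open_subset_closed by blast
  moreover have "x \<notin> polygon n p" using ch x unfolding chord_def by blast
  ultimately show "x \<in> outside (polygon n p)"
    by (intro supporting_segment_outside[OF h0 closed_polygon])
qed

text \<open>If neither chain were enclosed by the lid and the other chain, then both closed curves through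
  the lid would have the same interior, since the points just below the lid are inside of both.\<close>

lemma pocket_cases: "A \<inter> inside (D \<union> B) \<noteq> {} \<or> B \<inter> inside (D \<union> A) \<noteq> {}"
proof (rule ccontr)
  assume no: "\<not> ?thesis"
  let ?Q = "polygon (j - i + 1) (inner_sub p i j)" and ?R = "polygon (n - (j - i) + 1) (outer_sub p i j)"
  have Q: "?Q = D \<union> A" "?R = D \<union> B" using inner(2) outer(2) by auto
  have "p i \<noteq> p j" using simple_polygon_inj[OF P _ ij(2), of i] ij by auto
  then obtain x where x: "x \<in> open_segment (p i) (p j)" by (metis all_not_in_conv open_segment_eq_empty)
  have "x \<notin> polygon n p" using ch x unfolding chord_def by blast
  then obtain e where e: "e > 0" "ball x e \<subseteq> - polygon n p"
    using closed_polygon[of n p] by (metis ComplI open_Compl open_contains_ball)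
  let ?L = "ball x e \<inter> {y. h \<bullet> y < h \<bullet> p i}"
  have xQ: "x \<in> ?Q" "x \<in> ?R" using x segment_open_subset_closed unfolding Q by blast+
  have "?L \<inter> D = {}"
  proof -
    have False if "y \<in> D" "h \<bullet> y < h \<bullet> p i" for y using h_D[OF that(1)] that(2) by simp
    then show ?thesis by blast
  qed
  then have disj: "?L \<inter> ?Q = {}" "?L \<inter> ?R = {}" using e(2) unfolding Q P_eq by blast+
  have LQ: "?L \<subseteq> inside ?Q"
    by (rule lid_below_inside[OF inner(1) h0 _ xQ(1) e(1) disj(1)]) (use h_le ij in auto)
  have LR: "?L \<subseteq> inside ?R"
    by (rule lid_below_inside[OF outer(1) h0 _ xQ(2) e(1) disj(2)]) (use h_le ij in auto)
  have "?L \<noteq> {}"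
  proof -
    let ?y = "x - (e / (2 * norm h)) *\<^sub>R h"
    have "?y \<in> ball x e" using e h0 by (simp add: dist_norm)
    moreover have "0 < (e / (2 * norm h)) * (h \<bullet> h)" using e h0 by simp
    moreover have "h \<bullet> x = h \<bullet> p i" using h_D x segment_open_subset_closed by blast
    ultimately have "?y \<in> ?L" by (simp add: inner_diff_right)
    then show ?thesis by blast
  qed
  \<comment> \<open>The lid is common to both closed curves, and by assumption neither chain enters
    the inside of the other curve; so each curve is disjoint from the inside of the other.\<close>
  have dis: "inside ?R \<inter> ?Q = {}" "inside ?Q \<inter> ?R = {}"
    using no inside_no_overlap[of "D \<union> A"] inside_no_overlap[of "D \<union> B"] unfolding Q by blast+
  have "inside ?R \<subseteq> inside ?Q"
    by (rule connected_subset_inside[OF Jordan_polygon(2)[OF outer(1)] dis(1)]) (use LQ LR \<open>?L \<noteq> {}\<close> in blast)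
  moreover have "inside ?Q \<subseteq> inside ?R"
    by (rule connected_subset_inside[OF Jordan_polygon(2)[OF inner(1)] dis(2)]) (use LQ LR \<open>?L \<noteq> {}\<close> in blast)
  ultimately have eq: "inside ?Q = inside ?R" by (rule subset_antisym[rotated])
  have "?Q = frontier (inside ?Q)" by (rule Jordan_polygon(3)[OF inner(1), symmetric])
  also have "\<dots> = frontier (inside ?R)" by (simp only: eq)
  also have "\<dots> = ?R" by (rule Jordan_polygon(3)[OF outer(1)])
  finally have "?Q = ?R" .
  \<comment> \<open>By \<open>chord_not_adjacent\<close> this vertex of \<open>A\<close> is not an
    end of the lid, so it cannot lie on \<open>D\<close> or \<open>B\<close>.\<close>
  moreover have "p (Suc i) \<in> A" unfolding inner_chain_def using chord_not_adjacent(1)[OF P ch]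
    by (intro UN_I[of "Suc i"] vertex_in_edge(1)) auto
  ultimately have "p (Suc i) \<in> D \<union> B" unfolding Q by blast
  then have "p (Suc i) \<in> {p i, p j}"
    using \<open>p (Suc i) \<in> A\<close> chains_Int[OF P ij] chord_Int_chains(1)[OF P ch] by blast
  then show False
    using simple_polygon_inj[OF P, of "Suc i" i] simple_polygon_inj[OF P, of "Suc i" j] chord_not_adjacent(1)[OF P ch] ij by auto
qed

text \<open>Here \<open>X\<close> bounds the pocket together with the lid, and \<open>Y\<close> together with the lid bounds the
  polygon with the pocket filled in.\<close>

lemma pocket_regions:
  assumes XY: "X = A \<and> Y = B \<or> X = B \<and> Y = A" and ne: "X \<inter> inside (D \<union> Y) \<noteq> {}"
  shows "inside (X \<union> D) \<subseteq> outside (polygon n p)" "outside (Y \<union> D) \<subseteq> outside (polygon n p)"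
    "outside (polygon n p) \<subseteq> (X \<union> D) \<union> inside (X \<union> D) \<union> outside (Y \<union> D)"
    "X \<subseteq> inside (Y \<union> D) \<union> (Y \<union> D)"
proof -
  have P': "polygon n p = X \<union> Y" using XY P_eq by blast
  have "inside (D \<union> X) \<inter> inside (Y \<union> X) = {} \<and>
    inside (D \<union> X) \<union> inside (Y \<union> X) \<union> (X - {p i, p j}) = inside (D \<union> Y)"
    using XY
  proof
    assume XY: "X = A \<and> Y = B"
    then show ?thesis using chord_theta(2)[OF P ch] ne by simp
  next
    assume XY: "X = B \<and> Y = A"
    then show ?thesis using chord_theta(3)[OF P ch] ne by simp
  qed
  then have split: "inside (D \<union> X) \<inter> inside (Y \<union> X) = {}"
    "inside (D \<union> X) \<union> inside (Y \<union> X) \<union> (X - {p i, p j}) = inside (D \<union> Y)" by blast+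
  have ends: "{p i, p j} \<subseteq> D" by auto
  have io: "x \<in> outside S \<longleftrightarrow> x \<notin> S \<and> x \<notin> inside S" for x :: "real^2" and S
    by (auto simp: outside_inside)
  have c: "Y \<union> X = X \<union> Y" "D \<union> X = X \<union> D" "D \<union> Y = Y \<union> D" by auto
  note split = split[unfolded c]
  have no: "inside (Y \<union> D) \<inter> (Y \<union> D) = {}" "inside (X \<union> D) \<inter> (X \<union> D) = {}" by simp_all
  show "inside (X \<union> D) \<subseteq> outside (polygon n p)"
    unfolding P' subset_iff io using split no by blast
  show "outside (Y \<union> D) \<subseteq> outside (polygon n p)"
    unfolding P' subset_iff io using split ends by blast
  show "outside (polygon n p) \<subseteq> (X \<union> D) \<union> inside (X \<union> D) \<union> outside (Y \<union> D)"
    unfolding P' subset_iff io Un_iff using split by blast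
  show "X \<subseteq> inside (Y \<union> D) \<union> (Y \<union> D)"
    using split ends by blast
qed

text \<open>The chain \<open>X\<close> that is dropped lies in the closed region bounded by the
  remaining curve, hence in its hull. So a hull point that is still outside after filling the pocket
  is covered by the induction hypothesis.\<close>

lemma filled_hull:
  assumes P': "polygon n p = X \<union> Y" and Q: "polygon m q = Y \<union> D" and X: "X \<subseteq> inside (Y \<union> D) \<union> (Y \<union> D)"
  shows "polygon_hull n p \<subseteq> polygon_hull m q"
proof -
  have "X \<union> Y \<subseteq> polygon_hull m q"
    using X inside_subset_hull[of m q] polygon_subset_hull[of m q] unfolding Q by blast
  then have "p ` {..<n} \<subseteq> polygon_hull m q"
    using vertex_in_polygon[of _ n p] unfolding P' by blast
  then show ?thesis
    unfolding polygon_hull_def[of n p] by (rule hull_minimal) (rule convex_polygon_hull)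
qed

text \<open>The induction hypothesis is made an assumption so that the lemma serves twice: within
  the induction, and afterwards with \<open>outside_triangulation\<close> in its place, to cut along
  a prescribed lid. The pocket gets the interior triangulation, the rest of the hull this
  assumption.\<close>

lemma lid_decomposition:
  assumes IH: "\<And>m q a b. m < n \<Longrightarrow> simple_polygon m q \<Longrightarrow>
      a \<in> outside (polygon m q) \<inter> polygon_hull m q \<Longrightarrow> b \<in> outside (polygon m q) \<inter> polygon_hull m q \<Longrightarrow>
      cell_pair m q (outside (polygon m q)) a b"
  obtains X1 X2 R1 R2 where "R1 \<subseteq> outside (polygon n p)" "R2 \<subseteq> outside (polygon n p)"
    "\<And>x y. x \<in> X1 \<Longrightarrow> y \<in> X1 \<Longrightarrow> cell_pair (j - i + 1) (inner_sub p i j) R1 x y"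
    "\<And>x y. x \<in> X2 \<Longrightarrow> y \<in> X2 \<Longrightarrow> cell_pair (n - (j - i) + 1) (outer_sub p i j) R2 x y"
    "outside (polygon n p) \<inter> polygon_hull n p \<subseteq> X1 \<union> X2"
proof -
  let ?Q = "polygon (j - i + 1) (inner_sub p i j)" and ?R = "polygon (n - (j - i) + 1) (outer_sub p i j)"
  note adj = chord_not_adjacent[OF P ch]
  have m: "j - i + 1 < n" "n - (j - i) + 1 < n" using adj ij by auto
  show ?thesis
    using pocket_cases
  proof
    assume ne: "A \<inter> inside (D \<union> B) \<noteq> {}"
    have AB: "A = A \<and> B = B \<or> A = B \<and> B = A" by simp
    note r = pocket_regions[OF AB ne, folded inner(2) outer(2)]
    note r4 = pocket_regions(4)[OF AB ne]
    show ?thesis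
    proof (rule that[OF r(1,2)])
      show "cell_pair (j - i + 1) (inner_sub p i j) (inside ?Q) x y"
        if "x \<in> region (j - i + 1) (inner_sub p i j)" "y \<in> region (j - i + 1) (inner_sub p i j)" for x y
        by (rule inside_triangulation[OF inner(1) that])
      show "cell_pair (n - (j - i) + 1) (outer_sub p i j) (outside ?R) x y"
        if "x \<in> outside ?R \<inter> polygon_hull (n - (j - i) + 1) (outer_sub p i j)"
          "y \<in> outside ?R \<inter> polygon_hull (n - (j - i) + 1) (outer_sub p i j)" for x y
        by (rule IH[OF m(2) outer(1) that])
      show "outside (polygon n p) \<inter> polygon_hull n p \<subseteq> region (j - i + 1) (inner_sub p i j) \<union>
          (outside ?R \<inter> polygon_hull (n - (j - i) + 1) (outer_sub p i j))"
        using r(3) filled_hull[OF P_eq outer(2) r4] unfolding region_def by blast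
    qed
  next
    assume ne: "B \<inter> inside (D \<union> A) \<noteq> {}"
    have AB: "B = A \<and> A = B \<or> B = B \<and> A = A" by simp
    note r = pocket_regions[OF AB ne, folded inner(2) outer(2)]
    note r4 = pocket_regions(4)[OF AB ne]
    have P_eq': "polygon n p = B \<union> A" using P_eq by blast
    show ?thesis
    proof (rule that[OF r(2,1)])
      show "cell_pair (j - i + 1) (inner_sub p i j) (outside ?Q) x y"
        if "x \<in> outside ?Q \<inter> polygon_hull (j - i + 1) (inner_sub p i j)"
          "y \<in> outside ?Q \<inter> polygon_hull (j - i + 1) (inner_sub p i j)" for x y
        by (rule IH[OF m(1) inner(1) that])
      show "cell_pair (n - (j - i) + 1) (outer_sub p i j) (inside ?R) x y"
        if "x \<in> region (n - (j - i) + 1) (outer_sub p i j)" "y \<in> region (n - (j - i) + 1) (outer_sub p i j)" for x y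
        by (rule inside_triangulation[OF outer(1) that])
      show "outside (polygon n p) \<inter> polygon_hull n p \<subseteq>
          (outside ?Q \<inter> polygon_hull (j - i + 1) (inner_sub p i j)) \<union> region (n - (j - i) + 1) (outer_sub p i j)"
        using r(3) filled_hull[OF P_eq' inner(2) r4] unfolding region_def by blast
    qed
  qed
qed

end

text \<open>No base case occurs: the premises always provide a lid, and both polygons at it have
  fewer vertices.\<close>

theorem outside_triangulation:
  assumes "simple_polygon n p" "a \<in> outside (polygon n p) \<inter> polygon_hull n p" "b \<in> outside (polygon n p) \<inter> polygon_hull n p"
  shows "cell_pair n p (outside (polygon n p)) a b"
  using assms
proof (induction n arbitrary: p a b rule: less_induct)
  case (less n)
  obtain i j h where lid: "chord n p i j" "hull_edge n p h i j" "h \<noteq> 0"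
    using exists_lid[OF less.prems(1)] less.prems(2) by blast
  interpret polygon_lid n p h i j
    by (rule polygon_lid.intro[OF less.prems(1) lid])
  obtain X1 X2 R1 R2 where X: "R1 \<subseteq> outside (polygon n p)" "R2 \<subseteq> outside (polygon n p)"
    "\<And>x y. x \<in> X1 \<Longrightarrow> y \<in> X1 \<Longrightarrow> cell_pair (j - i + 1) (inner_sub p i j) R1 x y"
    "\<And>x y. x \<in> X2 \<Longrightarrow> y \<in> X2 \<Longrightarrow> cell_pair (n - (j - i) + 1) (outer_sub p i j) R2 x y"
    "outside (polygon n p) \<inter> polygon_hull n p \<subseteq> X1 \<union> X2"
    by (rule lid_decomposition, rule less.IH, assumption+, rule that)
  show ?case
    by (rule cell_pair_chord[OF lid(1) lid_outside X(1-4)]) (use X(5) less.prems in auto)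
qed

text \<open>Nothing lies strictly between two consecutive indices. For the pair of n - 1 and 0 the
  roles change: all of \<open>J\<close> lies between them.\<close>

lemma noncrossing_adjacent:
  assumes "J \<subseteq> {..<n}" "i < n" "j < n" "j = Suc i mod n \<or> i = Suc j mod n"
  shows "noncrossing J {i, j}"
proof -
  have *: "noncrossing J {k, Suc k mod n}" if "k < n" for k
  proof (cases "Suc k = n")
    case True
    then have "noncrossing J {0, k}" by (intro noncrossing_separated[of _ 0 k]) (use assms(1) in auto)
    then show ?thesis using True by (simp add: insert_commute)
  next
    case False
    then have "noncrossing {k, Suc k} J" by (intro noncrossing_separated[of _ k "Suc k"]) auto
    then show ?thesis using False that by (simp add: noncrossing_sym)
  qed
  show ?thesis using *[of i] *[of j] assms by (auto simp: insert_commute)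
qed

text \<open>If the hull edge is a lid, the cell is taken from the decomposition along this very lid,
  so its indices stay on one side of it.\<close>

lemma outside_cell_noncrossing_hull_edge:
  assumes P: "simple_polygon n p" and he: "hull_edge n p h i j" "h \<noteq> 0"
    and b: "b \<in> outside (polygon n p) \<inter> polygon_hull n p"
  shows "\<exists>J. cell n p (outside (polygon n p)) J \<and> b \<in> convex hull (p ` J) \<and> noncrossing J {i, j}"
proof (cases "j = Suc i mod n \<or> i = Suc j mod n")
  case True
  obtain J where J: "cell n p (outside (polygon n p)) J" "b \<in> convex hull (p ` J)"
    using outside_triangulation[OF P b b] unfolding cell_pair_def by blast
  moreover have "noncrossing J {i, j}"
    by (rule noncrossing_adjacent[OF _ _ _ True]) (use J he in \<open>auto simp: cell_def hull_edge_def\<close>)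
  ultimately show ?thesis by blast
next
  case False
  have main: "\<exists>J. cell n p (outside (polygon n p)) J \<and> b \<in> convex hull (p ` J) \<and> noncrossing J {i, j}"
    if ch: "chord n p i j" and he: "hull_edge n p h i j" for i j
  proof -
    interpret polygon_lid n p h i j
      by (rule polygon_lid.intro[OF P ch he assms(3)])
    obtain X1 X2 R1 R2 where X: "R1 \<subseteq> outside (polygon n p)" "R2 \<subseteq> outside (polygon n p)"
      "\<And>x y. x \<in> X1 \<Longrightarrow> y \<in> X1 \<Longrightarrow> cell_pair (j - i + 1) (inner_sub p i j) R1 x y"
      "\<And>x y. x \<in> X2 \<Longrightarrow> y \<in> X2 \<Longrightarrow> cell_pair (n - (j - i) + 1) (outer_sub p i j) R2 x y"
      "outside (polygon n p) \<inter> polygon_hull n p \<subseteq> X1 \<union> X2"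
      by (rule lid_decomposition, rule outside_triangulation, assumption+, rule that)
    consider "b \<in> X1" | "b \<in> X2" using X(5) b by blast
    then show "\<exists>J. cell n p (outside (polygon n p)) J \<and> b \<in> convex hull (p ` J) \<and> noncrossing J {i, j}"
    proof cases
      case 1
      obtain J where J: "cell (j - i + 1) (inner_sub p i j) R1 J" "b \<in> convex hull (inner_sub p i j ` J)"
        using X(3)[OF 1 1] unfolding cell_pair_def by blast
      have "J \<subseteq> {..<j - i + 1}" using J(1) unfolding cell_def by blast
      then have "noncrossing ((\<lambda>k. i + k) ` J) {i, j}"
        by (intro noncrossing_separated[of _ i j] inner_image ij) auto
      then show ?thesis
        using cell_inner[OF ch lid_outside J(1) X(1)] J(2) unfolding image_comp[symmetric] by blast
    next
      case 2
      obtain J where J: "cell (n - (j - i) + 1) (outer_sub p i j) R2 J" "b \<in> convex hull (outer_sub p i j ` J)"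
        using X(4)[OF 2 2] unfolding cell_pair_def by blast
      have "noncrossing {i, j} (skip i j ` J)"
        by (intro noncrossing_separated[of _ i j] outer_image ij) (use ij in auto)
      then show ?thesis
        using cell_outer[OF ch lid_outside J(1) X(2)] J(2) noncrossing_sym unfolding image_comp[symmetric] by blast
    qed
  qed
  have "open_segment (p i) (p j) \<inter> polygon n p = {}" "i < n" "j < n" "i \<noteq> j"
    using he False unfolding hull_edge_def by auto
  then have "chord n p i j \<or> chord n p j i"
    unfolding chord_def by (auto simp: open_segment_commute)
  then show ?thesis
  proof
    assume "chord n p i j" then show ?thesis by (rule main[OF _ he(1)])
  next
    assume "chord n p j i"
    then have "\<exists>J. cell n p (outside (polygon n p)) J \<and> b \<in> convex hull (p ` J) \<and> noncrossing J {j, i}"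
      by (rule main[OF _ hull_edge_sym[OF he(1)]])
    then show ?thesis by (simp add: insert_commute)
  qed
qed

section \<open>Points outside the convex hull\<close>

lemma link_dist_outside_hull:
  assumes "a \<notin> polygon_hull n p" "b \<notin> polygon_hull n p"
  shows "link_dist (outside (polygon n p)) a b \<le> 3"
proof -
  let ?H = "polygon_hull n p" and ?S = "outside (polygon n p)"
  have sep: "\<exists>h. \<forall>x\<in>?H. h \<bullet> x < h \<bullet> z" if z: "z \<notin> ?H" for z
  proof -
    obtain g m where "g \<bullet> z < m" "\<forall>x\<in>?H. g \<bullet> x > m"
      using separating_hyperplane_closed_point[OF convex_polygon_hull compact_imp_closed[OF compact_polygon_hull], of z n p] z by blast
    then show ?thesis by (intro exI[of _ "- g"]) auto
  qed
  obtain h1 where h1: "\<And>x. x \<in> ?H \<Longrightarrow> h1 \<bullet> x < h1 \<bullet> a" using sep[OF assms(1)] by blast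
  obtain h2 where h2: "\<And>x. x \<in> ?H \<Longrightarrow> h2 \<bullet> x < h2 \<bullet> b" using sep[OF assms(2)] by blast
  \<comment> \<open>\<open>perp h1\<close> and its negative are orthogonal to \<open>h1\<close>, and
    one of the two has a nonnegative inner product with \<open>h2\<close>.\<close>
  obtain d where d: "d \<noteq> 0" "h1 \<bullet> d \<ge> 0" "h2 \<bullet> d \<ge> 0"
  proof (cases "h1 = 0")
    case False
    show ?thesis
    proof (cases "h2 \<bullet> perp h1 \<ge> 0")
      case True then show ?thesis using that[of "perp h1"] False by (simp add: perp_eq_0_iff perp_inner_self)
    next
      case F: False then show ?thesis using that[of "- perp h1"] False by (simp add: perp_eq_0_iff perp_inner_self)
    qed
  next
    case True
    show ?thesis
    proof (cases "h2 = 0")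
      case F: False then show ?thesis using that[of h2] True by simp
    next
      case T: True
      have "(axis 1 1 :: real^2) \<noteq> 0" by simp
      then show ?thesis using that[of "axis 1 1"] True T by simp
    qed
  qed
  obtain r where r: "\<And>x. x \<in> ?H \<Longrightarrow> norm x \<le> r" "r > 0"
    using compact_imp_bounded[OF compact_polygon_hull[of n p]] unfolding bounded_pos by blast
  \<comment> \<open>With this length the norm of \<open>T *\<^sub>R d\<close> exceeds r + norm a +
    norm b by 1, so the segment from \<open>a\<close> to \<open>b\<close> translated by it leaves
    the disc of radius \<open>r\<close> around the hull.\<close>
  define T where "T = (r + norm a + norm b + 1) / norm d"
  have T: "T \<ge> 0" "T * norm d = r + norm a + norm b + 1"
    using r(2) d(1) unfolding T_def by (auto simp: add_nonneg_nonneg)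
  have ray: "closed_segment z (z + T *\<^sub>R d) \<subseteq> ?S" if "\<And>x. x \<in> ?H \<Longrightarrow> h \<bullet> x < h \<bullet> z" "h \<bullet> d \<ge> 0" for h z
  proof
    fix x assume "x \<in> closed_segment z (z + T *\<^sub>R d)"
    then obtain t where t: "0 \<le> t" "t \<le> 1" "x = (1 - t) *\<^sub>R z + t *\<^sub>R (z + T *\<^sub>R d)" unfolding in_segment by blast
    have "h \<bullet> x = h \<bullet> z + (t * T) * (h \<bullet> d)" unfolding t(3) by (simp add: inner_add_right algebra_simps)
    then have "h \<bullet> x \<ge> h \<bullet> z" using t T(1) that(2) by simp
    then have "x \<notin> ?H" using that(1) by force
    then show "x \<in> ?S" using outside_hull by blast
  qed
  have far: "closed_segment (a + T *\<^sub>R d) (b + T *\<^sub>R d) \<subseteq> ?S"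
  proof
    fix x assume "x \<in> closed_segment (a + T *\<^sub>R d) (b + T *\<^sub>R d)"
    then obtain t where t: "0 \<le> t" "t \<le> 1" "x = (1 - t) *\<^sub>R (a + T *\<^sub>R d) + t *\<^sub>R (b + T *\<^sub>R d)" unfolding in_segment by blast
    have x: "x = ((1 - t) *\<^sub>R a + t *\<^sub>R b) + T *\<^sub>R d" unfolding t(3) by (simp add: algebra_simps)
    have "norm ((1 - t) *\<^sub>R a + t *\<^sub>R b) \<le> norm ((1 - t) *\<^sub>R a) + norm (t *\<^sub>R b)" by (rule norm_triangle_ineq)
    also have "\<dots> \<le> 1 * norm a + 1 * norm b"
      using t unfolding norm_scaleR by (intro add_mono mult_right_mono) auto
    finally have "norm ((1 - t) *\<^sub>R a + t *\<^sub>R b) \<le> norm a + norm b" by simp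
    moreover have "norm (T *\<^sub>R d) \<le> norm x + norm ((1 - t) *\<^sub>R a + t *\<^sub>R b)"
      using norm_triangle_ineq4[of x "(1 - t) *\<^sub>R a + t *\<^sub>R b"] unfolding x by simp
    moreover have "norm (T *\<^sub>R d) = r + norm a + norm b + 1" using T by simp
    ultimately have "norm x > r" by linarith
    then have "x \<notin> ?H" using r(1) by force
    then show "x \<in> ?S" using outside_hull by blast
  qed
  let ?q = "\<lambda>k. if k = 0 then a else if k = 1 then a + T *\<^sub>R d else if k = 2 then b + T *\<^sub>R d else b"
  have "closed_segment (?q k) (?q (Suc k)) \<subseteq> ?S" if "k < 3" for k :: nat
  proof -
    have k: "k = 0 \<or> k = 1 \<or> k = 2" using that by auto
    show ?thesis
      using k ray[of h1 a] ray[of h2 b] h1 h2 d far by (auto simp: closed_segment_commute[of _ b])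
  qed
  then have "polygonal_path_in ?S a b 3"
    unfolding polygonal_path_in_def by (intro exI[of _ ?q]) auto
  then show ?thesis unfolding link_dist_def by (rule Least_le)
qed

lemma int_polygon_eq: "int_polygon P = inside P"
  unfolding int_polygon_def inside_def by auto

lemma ext_polygon_eq: "ext_polygon P = outside P"
  unfolding ext_polygon_def outside_def by auto

lemma card_3_increasing:
  assumes "card (I :: nat set) = 3"
  obtains i1 i2 i3 where "i1 < i2" "i2 < i3" "I = {i1, i2, i3}"
proof -
  obtain a b c where abc: "I = {a, b, c}" "a \<noteq> b" "a \<noteq> c" "b \<noteq> c" using assms by (auto simp: card_3_iff)
  then consider "a < b" "b < c" | "a < c" "c < b" | "b < a" "a < c" | "b < c" "c < a" | "c < a" "a < b" | "c < b" "b < a"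
    by linarith
  then show ?thesis
    using that abc(1) by cases (auto simp: insert_commute)
qed

lemma noncrossing_cells_close:
  assumes "cell n p R I" "cell n p R' J" "noncrossing I J"
  shows "\<exists>i\<in>I. \<exists>j\<in>J. at_most_edges_apart n i j (n div 2 - 2)"
proof -
  have I: "card I = 3" "I \<subseteq> {..<n}" and J: "card J = 3" "J \<subseteq> {..<n}"
    using assms unfolding cell_def by auto
  obtain i1 i2 i3 where i: "i1 < i2" "i2 < i3" "I = {i1, i2, i3}" using card_3_increasing[OF I(1)] .
  obtain j1 j2 j3 where j: "j1 < j2" "j2 < j3" "J = {j1, j2, j3}" using card_3_increasing[OF J(1)] .
  show ?thesis
    by (rule noncrossing_triples_close[OF assms(3) i(1,2) _ I(2) j(1,2) _ J(2)]) (use i j in auto)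
qed

lemma at_most_edges_apart_mono: "at_most_edges_apart n i j k \<Longrightarrow> k \<le> k' \<Longrightarrow> at_most_edges_apart n i j k'"
  unfolding at_most_edges_apart_def by auto

text \<open>The point \<open>a\<close> sees both ends of an edge of the convex hull, and this pair does not interleave
  with the cell of \<open>b\<close>.\<close>

lemma outside_hull_pocket:
  assumes P: "simple_polygon n p" and a: "a \<notin> polygon_hull n p"
    and b: "b \<in> outside (polygon n p) \<inter> polygon_hull n p"
  shows "\<exists>i<n. \<exists>j<n. open_segment a (p i) \<subseteq> outside (polygon n p) \<and>
    open_segment b (p j) \<subseteq> outside (polygon n p) \<and> at_most_edges_apart n i j ((n + 1) div 2 - 2)"
proof -
  obtain i j h where he: "hull_edge n p h i j" "h \<noteq> 0" "h \<bullet> p i < h \<bullet> a"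
    using exists_visible_hull_edge[OF P a] by blast
  have ij: "i < n" "j < n" "i \<noteq> j" "h \<bullet> p i = h \<bullet> p j" "\<And>k. k < n \<Longrightarrow> h \<bullet> p k \<le> h \<bullet> p i"
    using he(1) unfolding hull_edge_def by auto
  obtain J where J: "cell n p (outside (polygon n p)) J" "b \<in> convex hull (p ` J)" "noncrossing J {i, j}"
    using outside_cell_noncrossing_hull_edge[OF P he(1,2) b] by blast
  have J': "card J = 3" "J \<subseteq> {..<n}" using J(1) unfolding cell_def by auto
  obtain j1 j2 j3 where jj: "j1 < j2" "j2 < j3" "J = {j1, j2, j3}" using card_3_increasing[OF J'(1)] .
  \<comment> \<open>\<open>noncrossing_triple_pair_close\<close> takes the pair in increasing order,
    but a hull edge has no order.\<close>
  have "min i j < max i j" "{min i j, max i j} = {i, j}" using ij(3) by (auto simp: min_def max_def)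
  then obtain y x where xy: "y \<in> J" "x \<in> {i, j}" "at_most_edges_apart n y x ((n + 1) div 2 - 2)"
    using noncrossing_triple_pair_close[OF J(3) jj(1,2) _ J'(2), of "min i j" "max i j"] jj(3) ij by auto
  \<comment> \<open>Up to its end point \<open>p x\<close> the segment stays strictly above the
    supporting line, hence off the hull.\<close>
  have "open_segment a (p x) \<subseteq> outside (polygon n p)"
  proof
    fix z assume "z \<in> open_segment a (p x)"
    then obtain t where t: "0 < t" "t < 1" "z = (1 - t) *\<^sub>R a + t *\<^sub>R p x" unfolding in_segment by blast
    have "h \<bullet> p x = h \<bullet> p i" using xy(2) ij by auto
    then have "h \<bullet> z = h \<bullet> p i + (1 - t) * (h \<bullet> a - h \<bullet> p i)"
      unfolding t by (simp add: inner_add_right algebra_simps)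
    moreover have "(1 - t) * (h \<bullet> a - h \<bullet> p i) > 0" using t he by simp
    ultimately have "h \<bullet> p i < h \<bullet> z" by linarith
    then have "z \<notin> polygon_hull n p" using hull_halfplane[of n h p "h \<bullet> p i"] ij(5) by fastforce
    then show "z \<in> outside (polygon n p)" using outside_hull by blast
  qed
  moreover have "open_segment b (p y) \<subseteq> outside (polygon n p)"
    by (rule cell_sees_vertex[OF J(1,2) _ xy(1)]) (use b in \<open>auto simp: outside_def\<close>)
  ultimately show ?thesis
    using xy J'(2) ij at_most_edges_apart_sym by blast
qed

theorem theorem4p2:
  fixes n :: nat and p :: "nat \<Rightarrow> real^2"
  assumes "simple_polygon n p"
  shows "(n \<ge> 4 \<longrightarrow> (\<forall>a\<in>int_polygon (polygon n p). \<forall>b\<in>int_polygon (polygon n p).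
            (\<exists>i<n. \<exists>j<n. open_segment a (p i) \<subseteq> int_polygon (polygon n p) \<and>
                        open_segment b (p j) \<subseteq> int_polygon (polygon n p) \<and>
                        at_most_edges_apart n i j (n div 2 - 2))))
       \<and> (n \<ge> 5 \<longrightarrow> (\<forall>a\<in>ext_polygon (polygon n p). \<forall>b\<in>ext_polygon (polygon n p).
            (\<exists>i<n. \<exists>j<n. open_segment a (p i) \<subseteq> ext_polygon (polygon n p) \<and>
                        open_segment b (p j) \<subseteq> ext_polygon (polygon n p) \<and>
                        at_most_edges_apart n i j ((n + 1) div 2 - 2))
            \<or> link_dist (ext_polygon (polygon n p)) a b \<le> 3))"
  unfolding int_polygon_eq ext_polygon_eq
proof (intro conjI impI ballI)
  let ?P = "polygon n p"
  fix a b assume "a \<in> inside ?P" "b \<in> inside ?P"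
  then have ab: "a \<in> region n p" "b \<in> region n p" "a \<notin> ?P" "b \<notin> ?P"
    by (auto simp: region_def inside_def)
  obtain I J where IJ: "cell n p (inside ?P) I" "cell n p (inside ?P) J"
    "a \<in> convex hull (p ` I)" "b \<in> convex hull (p ` J)" "noncrossing I J"
    using inside_triangulation[OF assms ab(1,2)] unfolding cell_pair_def by blast
  obtain i j where ij: "i \<in> I" "j \<in> J" "at_most_edges_apart n i j (n div 2 - 2)"
    using noncrossing_cells_close[OF IJ(1,2,5)] by blast
  moreover have "i < n" "j < n" using IJ ij unfolding cell_def by auto
  ultimately show "\<exists>i<n. \<exists>j<n. open_segment a (p i) \<subseteq> inside ?P \<and>
      open_segment b (p j) \<subseteq> inside ?P \<and> at_most_edges_apart n i j (n div 2 - 2)"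
    using cell_sees_vertex[OF IJ(1,3) ab(3)] cell_sees_vertex[OF IJ(2,4) ab(4)] by blast
next
  let ?P = "polygon n p" and ?H = "polygon_hull n p"
  fix a b assume ab: "a \<in> outside ?P" "b \<in> outside ?P"
  have notP: "a \<notin> ?P" "b \<notin> ?P" using ab by (auto simp: outside_def)
  consider "a \<notin> ?H" "b \<notin> ?H" | "a \<in> ?H" "b \<in> ?H" | "a \<notin> ?H" "b \<in> ?H" | "a \<in> ?H" "b \<notin> ?H" by blast
  then show "(\<exists>i<n. \<exists>j<n. open_segment a (p i) \<subseteq> outside ?P \<and>
      open_segment b (p j) \<subseteq> outside ?P \<and> at_most_edges_apart n i j ((n + 1) div 2 - 2))
    \<or> link_dist (outside ?P) a b \<le> 3"
  proof cases
    case 1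
    then show ?thesis using link_dist_outside_hull by blast
  next
    case 2
    then obtain I J where IJ: "cell n p (outside ?P) I" "cell n p (outside ?P) J"
      "a \<in> convex hull (p ` I)" "b \<in> convex hull (p ` J)" "noncrossing I J"
      using outside_triangulation[OF assms, of a b] ab unfolding cell_pair_def by blast
    obtain i j where ij: "i \<in> I" "j \<in> J" "at_most_edges_apart n i j (n div 2 - 2)"
      using noncrossing_cells_close[OF IJ(1,2,5)] by blast
    \<comment> \<open>Two cells give the bound of the interior case, which is at least as
      strong.\<close>
    then have "at_most_edges_apart n i j ((n + 1) div 2 - 2)"
      by (rule_tac at_most_edges_apart_mono) auto
    moreover have "i < n" "j < n" using IJ ij unfolding cell_def by auto
    ultimately show ?thesis
      using cell_sees_vertex[OF IJ(1,3) notP(1) ij(1)] cell_sees_vertex[OF IJ(2,4) notP(2) ij(2)] by blast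
  next
    case 3
    then show ?thesis using outside_hull_pocket[OF assms, of a b] ab by blast
  next
    case 4
    then show ?thesis
      using outside_hull_pocket[OF assms, of b a] ab at_most_edges_apart_sym by blast
  qed
qed

end
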